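(* For every integer $n\ge2$ there exists a $4n$-dimensional nilmanifold $\Gamma\backslash G$, with $\mathfrak g=\mathrm{Lie}(G)$ a 4-step nilpotent Lie algebra, which admits two families of non-equivalent (left-invariant) hypersymplectic structures $(J_c,\widehat E_c,\widehat g_c)$ and $(J_c,E_c,g_c)$, indexed by a parameter $c>0$, such that for every $c>0$ the metric $\widehat g_c$ is flat and complete, and the metric $g_c$ is non-flat and complete.
   Context: A nilmanifold is a compact quotient $\Gamma\backslash G$ of a connected, simply connected nilpotent Lie group $G$ by a lattice $\Gamma$ (a discrete co-compact subgroup). A left-invariant structure on $\Gamma\backslash G$ is one induced by a structure on the Lie algebra $\mathfrak g$ of $G$. For an endomorphism $A$ of a real Lie algebra $\mathfrak g$ put $N_A(X,Y)=-A^2[X,Y]+A[AX,Y]+A[X,AY]-[AX,AY]$; $A$ is integrable if $N_A\equiv0$. A complex structure is an integrable $J$ with $J^2=-\mathrm{Id}$; a product structure is an integrable $E$ with $E^2=\mathrm{Id}$, $E\ne\pm\mathrm{Id}$. A hypersymplectic structure on $\mathfrak g$ is a triple $(J,E,g)$ where $J$ is a complex structure, $E$ is a product structure, $J\circ E=-E\circ J$, and $g$ is a nondegenerate symmetric bilinear form with $g(JX,JY)=g(X,Y)$ and $g(EX,EY)=-g(X,Y)$ for all $X,Y$, such that $\omega_1(X,Y)=g(JX,Y)$ or, equivalently, $\omega_3(X,Y)=g((J\circ E)X,Y)$ is closed with respect to the Chevalley–Eilenberg differential ($d\alpha(X,Y)=-\alpha([X,Y])$ on $\mathfrak g^*$).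 Two complex structures $J_1,J_2$ on $\mathfrak g$ are equivalent if there is a Lie algebra automorphism $\psi$ of $\mathfrak g$ with $\psi\circ J_1=J_2\circ\psi$. Two hypersymplectic structures $(J_1,E_1,g_1)$, $(J_2,E_2,g_2)$ on $\mathfrak g$ are equivalent if there is a Lie algebra automorphism $\psi$ of $\mathfrak g$ with $\psi\circ J_1=J_2\circ\psi$, $\psi\circ E_1=E_2\circ\psi$ and $\psi^*g_2=g_1$. "Families of non-equivalent structures" means that within each family members with different values of $c$ are not equivalent. Flat/complete refer to the (pseudo-Riemannian) Levi-Civita connection: vanishing curvature, respectively geodesic completeness. *)

theory Defs
  imports "HOL-Analysis.Analysis" "HOL-Algebra.Coset"
begin

section \<open>Smooth manifolds and Lie groups\<close>

primrec Ck_on :: "nat \<Rightarrow> 'a::real_normed_vector set \<Rightarrow> ('a \<Rightarrow> 'b::real_normed_vector) \<Rightarrow> bool"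
  where
    "Ck_on 0 S f \<longleftrightarrow> continuous_on S f"
  | "Ck_on (Suc k) S f \<longleftrightarrow>
       (\<exists>f'. (\<forall>x\<in>S. (f has_derivative f' x) (at x)) \<and> (\<forall>v. Ck_on k S (\<lambda>x. f' x v)))"

text \<open>Used for open \<open>S\<close> in a finite-dimensional space only.\<close>
definition smooth_on :: "'a::real_normed_vector set \<Rightarrow> ('a \<Rightarrow> 'b::real_normed_vector) \<Rightarrow> bool"
  where "smooth_on S f \<longleftrightarrow> (\<forall>k. Ck_on k S f)"

text \<open>A chart is a pair \<open>(U, \<phi>)\<close>; only the values of \<open>\<phi>\<close> on \<open>U\<close> matter.\<close>
type_synonym ('g, 'a) chart = "'g set \<times> ('g \<Rightarrow> 'a)"

abbreviation chart_inv :: "('g, 'a) chart \<Rightarrow> 'a \<Rightarrow> 'g"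
  where "chart_inv c \<equiv> inv_into (fst c) (snd c)"

locale smooth_manifold =
  fixes T :: "'g topology" and A :: "('g, 'a::euclidean_space) chart set"
  assumes Hausdorff: "Hausdorff_space T"
    and second_countable: "second_countable T"
    and atlas_covers: "(\<Union>c\<in>A. fst c) = topspace T"
    and chart_domain: "c \<in> A \<Longrightarrow> openin T (fst c)"
    and chart_image: "c \<in> A \<Longrightarrow> open (snd c ` fst c)"
    and chart_homeo:
      "c \<in> A \<Longrightarrow> homeomorphic_map (subtopology T (fst c)) (top_of_set (snd c ` fst c)) (snd c)"
    and chart_compatible:
      "c \<in> A \<Longrightarrow> d \<in> A \<Longrightarrow> smooth_on (snd c ` (fst c \<inter> fst d)) (snd d \<circ> chart_inv c)"

locale lie_group = group G + smooth_manifold T A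
  for G :: "'g monoid" (structure) and T :: "'g topology"
    and A :: "('g, 'a::euclidean_space) chart set" +
  assumes carrier_eq: "carrier G = topspace T"
    and continuous_mult: "continuous_map (prod_topology T T) T (\<lambda>(x, y). x \<otimes> y)"
    and continuous_inv: "continuous_map T T (\<lambda>x. inv x)"
    and smooth_mult:
      "b \<in> A \<Longrightarrow> c \<in> A \<Longrightarrow> d \<in> A \<Longrightarrow>
       smooth_on {(u, v). u \<in> snd b ` fst b \<and> v \<in> snd c ` fst c \<and>
                          chart_inv b u \<otimes> chart_inv c v \<in> fst d}
                 (\<lambda>(u, v). snd d (chart_inv b u \<otimes> chart_inv c v))"
    and smooth_inv:
      "c \<in> A \<Longrightarrow> d \<in> A \<Longrightarrow>
       smooth_on {u \<in> snd c ` fst c. inv (chart_inv c u) \<in> fst d}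
                 (\<lambda>u. snd d (inv (chart_inv c u)))"

text \<open>
  A chart \<open>e\<close> around the identity identifies the tangent space at the identity, that is, the
  underlying vector space of the Lie algebra, with \<open>'a\<close>. For \<open>X :: 'a\<close>,
  \<open>left_field G e c X x\<close> is the value at \<open>x\<close> of the left-invariant vector field
  generated by \<open>X\<close> (the differential of left translation by \<open>x\<close> applied to \<open>X\<close>),
  written in the chart \<open>c\<close>.
\<close>
definition left_field ::
    "'g monoid \<Rightarrow> ('g, 'a::euclidean_space) chart \<Rightarrow> ('g, 'a) chart \<Rightarrow> 'a \<Rightarrow> 'g \<Rightarrow> 'a"
  where "left_field G e c X x =
    frechet_derivative (\<lambda>v. snd c (x \<otimes>\<^bsub>G\<^esub> chart_inv e v)) (at (snd e \<one>\<^bsub>G\<^esub>)) X"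

text \<open>
  The bracket of the Lie algebra: the commutator of left-invariant vector fields, evaluated at the
  identity. In coordinates \<open>[V, W] = DW(V) - DV(W)\<close>.
\<close>
definition lie_bracket ::
    "'g monoid \<Rightarrow> ('g, 'a::euclidean_space) chart \<Rightarrow> 'a \<Rightarrow> 'a \<Rightarrow> 'a"
  where "lie_bracket G e X Y =
    (let F = (\<lambda>Z u. left_field G e e Z (chart_inv e u)); p = snd e \<one>\<^bsub>G\<^esub> in
       frechet_derivative (F Y) (at p) (F X p) - frechet_derivative (F X) (at p) (F Y p))"


section \<open>Nilmanifolds\<close>

primrec lower_central :: "('a::real_vector \<Rightarrow> 'a \<Rightarrow> 'a) \<Rightarrow> nat \<Rightarrow> 'a set"
  where
    "lower_central br 0 = UNIV"
  | "lower_central br (Suc k) = span {br X Y |X Y. Y \<in> lower_central br k}"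

definition nilpotent_of_step :: "nat \<Rightarrow> ('a::real_vector \<Rightarrow> 'a \<Rightarrow> 'a) \<Rightarrow> bool"
  where "nilpotent_of_step k br \<longleftrightarrow>
    lower_central br k = {0} \<and> (\<forall>j<k. lower_central br j \<noteq> {0})"

text \<open>
  The analogue of \<^const>\<open>simply_connected\<close> for abstract topologies: any two loops are freely
  homotopic (through loops).
\<close>
definition simply_connected_space :: "'g topology \<Rightarrow> bool"
  where "simply_connected_space X \<longleftrightarrow>
    (\<forall>p q. pathin X p \<and> p 1 = p 0 \<and> pathin X q \<and> q 1 = q 0 \<longrightarrow>
       homotopic_with (\<lambda>r. r 1 = r 0) (top_of_set {0..1}) X p q)"

text \<open>
  The points of \<open>\<Gamma>\<setminus>G\<close> are the cosets \<open>\<Gamma> #> x\<close>. The topology \<open>Q\<close> below is the quotient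
  topology, which is the only one that makes the projection a quotient map.
\<close>
definition lattice_in :: "'g monoid \<Rightarrow> 'g topology \<Rightarrow> 'g set \<Rightarrow> bool"
  where "lattice_in G T \<Gamma> \<longleftrightarrow>
    subgroup \<Gamma> G \<and> subtopology T \<Gamma> = discrete_topology \<Gamma> \<and>
    (\<exists>Q. quotient_map T Q (\<lambda>x. \<Gamma> #>\<^bsub>G\<^esub> x) \<and> compact_space Q)"

text \<open>As usual, a connected Lie group is called nilpotent if its Lie algebra is.\<close>
locale nilmanifold = lie_group G T A
  for G :: "'g monoid" and T :: "'g topology" and A :: "('g, 'a::euclidean_space) chart set" +
  fixes e :: "('g, 'a) chart" and \<Gamma> :: "'g set"
  assumes identity_chart: "e \<in> A" "\<one>\<^bsub>G\<^esub> \<in> fst e"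
    and connected: "connected_space T"
    and simply_connected: "simply_connected_space T"
    and nilpotent: "\<exists>k. nilpotent_of_step k (lie_bracket G e)"
    and lattice: "lattice_in G T \<Gamma>"


section \<open>Hypersymplectic structures on a Lie algebra with bracket \<open>br\<close>\<close>

definition nijenhuis :: "('a::real_vector \<Rightarrow> 'a \<Rightarrow> 'a) \<Rightarrow> ('a \<Rightarrow> 'a) \<Rightarrow> 'a \<Rightarrow> 'a \<Rightarrow> 'a"
  where "nijenhuis br A X Y =
    - A (A (br X Y)) + A (br (A X) Y) + A (br X (A Y)) - br (A X) (A Y)"

definition integrable_endo :: "('a::real_vector \<Rightarrow> 'a \<Rightarrow> 'a) \<Rightarrow> ('a \<Rightarrow> 'a) \<Rightarrow> bool"
  where "integrable_endo br A \<longleftrightarrow> (\<forall>X Y. nijenhuis br A X Y = 0)"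

definition complex_structure :: "('a::real_vector \<Rightarrow> 'a \<Rightarrow> 'a) \<Rightarrow> ('a \<Rightarrow> 'a) \<Rightarrow> bool"
  where "complex_structure br J \<longleftrightarrow>
    linear J \<and> integrable_endo br J \<and> J \<circ> J = (\<lambda>X. - X)"

definition product_structure :: "('a::real_vector \<Rightarrow> 'a \<Rightarrow> 'a) \<Rightarrow> ('a \<Rightarrow> 'a) \<Rightarrow> bool"
  where "product_structure br E \<longleftrightarrow>
    linear E \<and> integrable_endo br E \<and> E \<circ> E = id \<and> E \<noteq> id \<and> E \<noteq> (\<lambda>X. - X)"

definition metric :: "('a::real_vector \<Rightarrow> 'a \<Rightarrow> real) \<Rightarrow> bool"
  where "metric g \<longleftrightarrow>
    bilinear g \<and> (\<forall>X Y. g X Y = g Y X) \<and> (\<forall>X. (\<forall>Y. g X Y = 0) \<longrightarrow> X = 0)"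

text \<open>
  The Chevalley--Eilenberg differential of a 2-form: the derivation extending
  \<open>d\<alpha>(X, Y) = - \<alpha>([X, Y])\<close>.
\<close>
definition ce_diff2 ::
    "('a::real_vector \<Rightarrow> 'a \<Rightarrow> 'a) \<Rightarrow> ('a \<Rightarrow> 'a \<Rightarrow> real) \<Rightarrow> 'a \<Rightarrow> 'a \<Rightarrow> 'a \<Rightarrow> real"
  where "ce_diff2 br \<omega> X Y Z = - \<omega> (br X Y) Z + \<omega> (br X Z) Y - \<omega> (br Y Z) X"

definition hypersymplectic ::
    "('a::real_vector \<Rightarrow> 'a \<Rightarrow> 'a) \<Rightarrow> ('a \<Rightarrow> 'a) \<Rightarrow> ('a \<Rightarrow> 'a) \<Rightarrow> ('a \<Rightarrow> 'a \<Rightarrow> real) \<Rightarrow> bool"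
  where "hypersymplectic br J E g \<longleftrightarrow>
    complex_structure br J \<and> product_structure br E \<and> (\<forall>X. J (E X) = - E (J X)) \<and>
    metric g \<and> (\<forall>X Y. g (J X) (J Y) = g X Y) \<and> (\<forall>X Y. g (E X) (E Y) = - g X Y) \<and>
    (\<forall>X Y Z. ce_diff2 br (\<lambda>U V. g (J U) V) X Y Z = 0)"

definition lie_automorphism :: "('a::real_vector \<Rightarrow> 'a \<Rightarrow> 'a) \<Rightarrow> ('a \<Rightarrow> 'a) \<Rightarrow> bool"
  where "lie_automorphism br \<psi> \<longleftrightarrow>
    linear \<psi> \<and> bij \<psi> \<and> (\<forall>X Y. \<psi> (br X Y) = br (\<psi> X) (\<psi> Y))"

definition equivalent_hypersymplectic ::
    "('a::real_vector \<Rightarrow> 'a \<Rightarrow> 'a) \<Rightarrow> ('a \<Rightarrow> 'a) \<Rightarrow> ('a \<Rightarrow> 'a) \<Rightarrow> ('a \<Rightarrow> 'a \<Rightarrow> real)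
      \<Rightarrow> ('a \<Rightarrow> 'a) \<Rightarrow> ('a \<Rightarrow> 'a) \<Rightarrow> ('a \<Rightarrow> 'a \<Rightarrow> real) \<Rightarrow> bool"
  where "equivalent_hypersymplectic br J1 E1 g1 J2 E2 g2 \<longleftrightarrow>
    (\<exists>\<psi>. lie_automorphism br \<psi> \<and> \<psi> \<circ> J1 = J2 \<circ> \<psi> \<and> \<psi> \<circ> E1 = E2 \<circ> \<psi> \<and>
         (\<forall>X Y. g2 (\<psi> X) (\<psi> Y) = g1 X Y))"


section \<open>Curvature and completeness of left-invariant metrics\<close>

text \<open>
  The Levi-Civita connection of a left-invariant metric is left-invariant, hence given by a bilinear
  product on the Lie algebra. For a nondegenerate \<open>g\<close> it exists and is unique.
\<close>
definition is_levi_civita ::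
    "('a::real_vector \<Rightarrow> 'a \<Rightarrow> 'a) \<Rightarrow> ('a \<Rightarrow> 'a \<Rightarrow> real) \<Rightarrow> ('a \<Rightarrow> 'a \<Rightarrow> 'a) \<Rightarrow> bool"
  where "is_levi_civita br g D \<longleftrightarrow>
    bilinear D \<and> (\<forall>X Y. D X Y - D Y X = br X Y) \<and>
    (\<forall>X Y Z. g (D X Y) Z + g Y (D X Z) = 0)"

definition levi_civita ::
    "('a::real_vector \<Rightarrow> 'a \<Rightarrow> 'a) \<Rightarrow> ('a \<Rightarrow> 'a \<Rightarrow> real) \<Rightarrow> 'a \<Rightarrow> 'a \<Rightarrow> 'a"
  where "levi_civita br g = (THE D. is_levi_civita br g D)"

definition curvature ::
    "('a::real_vector \<Rightarrow> 'a \<Rightarrow> 'a) \<Rightarrow> ('a \<Rightarrow> 'a \<Rightarrow> 'a) \<Rightarrow> 'a \<Rightarrow> 'a \<Rightarrow> 'a \<Rightarrow> 'a"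
  where "curvature br D X Y Z = D X (D Y Z) - D Y (D X Z) - D (br X Y) Z"

definition flat_metric :: "('a::real_vector \<Rightarrow> 'a \<Rightarrow> 'a) \<Rightarrow> ('a \<Rightarrow> 'a \<Rightarrow> real) \<Rightarrow> bool"
  where "flat_metric br g \<longleftrightarrow> (\<forall>X Y Z. curvature br (levi_civita br g) X Y Z = 0)"

text \<open>The curve \<open>\<gamma>\<close> in \<open>G\<close> has at time \<open>t\<close> the velocity of the left-invariant field of \<open>X\<close>.\<close>
definition has_left_velocity ::
    "'g monoid \<Rightarrow> ('g, 'a::euclidean_space) chart set \<Rightarrow> ('g, 'a) chart \<Rightarrow>
      (real \<Rightarrow> 'g) \<Rightarrow> real \<Rightarrow> 'a \<Rightarrow> bool"
  where "has_left_velocity G A e \<gamma> t X \<longleftrightarrow>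
    (\<forall>c\<in>A. \<gamma> t \<in> fst c \<longrightarrow>
       ((snd c \<circ> \<gamma>) has_vector_derivative left_field G e c X (\<gamma> t)) (at t))"

text \<open>
  \<open>\<sigma>\<close> is a geodesic of \<open>\<Gamma>\<setminus>G\<close>, parametrised by the whole real line, for the metric induced by
  \<open>g\<close>. Left-invariant fields descend to a global frame of \<open>\<Gamma>\<setminus>G\<close>, and \<open>x t\<close> is the velocity of
  \<open>\<sigma>\<close> at \<open>t\<close> in this frame; it is computed from local lifts \<open>\<gamma>\<close> of \<open>\<sigma>\<close> to \<open>G\<close>. In this frame
  the covariant derivative of the velocity along \<open>\<sigma>\<close> is \<open>x' + D x x\<close>, with \<open>D\<close> the Levi-Civita
  product, so the last conjunct is the geodesic equation.
\<close>
definition complete_geodesic ::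
    "'g monoid \<Rightarrow> 'g topology \<Rightarrow> ('g, 'a::euclidean_space) chart set \<Rightarrow> ('g, 'a) chart \<Rightarrow> 'g set \<Rightarrow>
      ('a \<Rightarrow> 'a \<Rightarrow> real) \<Rightarrow> (real \<Rightarrow> 'g set) \<Rightarrow> (real \<Rightarrow> 'a) \<Rightarrow> bool"
  where "complete_geodesic G T A e \<Gamma> g \<sigma> x \<longleftrightarrow>
    (\<forall>s. \<exists>\<epsilon>>0. \<exists>\<gamma>.
       continuous_map (top_of_set {s-\<epsilon><..<s+\<epsilon>}) T \<gamma> \<and>
       (\<forall>t\<in>{s-\<epsilon><..<s+\<epsilon>}. \<sigma> t = \<Gamma> #>\<^bsub>G\<^esub> \<gamma> t \<and> has_left_velocity G A e \<gamma> t (x t))) \<and>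
    (\<forall>t. (x has_vector_derivative - levi_civita (lie_bracket G e) g (x t) (x t)) (at t))"

text \<open>Geodesic completeness: all initial data are realised by a geodesic defined for all times.\<close>
definition complete_metric ::
    "'g monoid \<Rightarrow> 'g topology \<Rightarrow> ('g, 'a::euclidean_space) chart set \<Rightarrow> ('g, 'a) chart \<Rightarrow> 'g set \<Rightarrow>
      ('a \<Rightarrow> 'a \<Rightarrow> real) \<Rightarrow> bool"
  where "complete_metric G T A e \<Gamma> g \<longleftrightarrow>
    (\<forall>P \<in> rcosets\<^bsub>G\<^esub> \<Gamma>. \<forall>X. \<exists>\<sigma> x.
       complete_geodesic G T A e \<Gamma> g \<sigma> x \<and> \<sigma> 0 = P \<and> x 0 = X)"

end

theory Submission
  imports Defs
begin

text \<open>
  Let \<open>\<Omega>\<close> be the standard complex symplectic form on \<open>\<complex>\<^sup>2\<^sup>n\<close> and \<open>J\<close> the multiplication by \<open>\<i>\<close>. A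
  hypersymplectic structure with this \<open>J\<close> amounts to a conjugation \<open>E\<close> that is compatible with
  \<open>\<Omega>\<close>, the metric being \<open>Im \<Omega>(u, E v)\<close>, together with a product \<open>D\<close> that is parallel for \<open>J\<close>,
  \<open>E\<close>, \<open>\<Omega>\<close> and satisfies \<open>D u v - D v u = [u, v]\<close>; then \<open>D\<close> is the Levi-Civita product, and
  integrability and closedness are automatic. A bracket with a flat such product for the standard
  conjugation also has a product for the conjugation twisted by the exponential of a nilpotent,
  purely imaginary element of the symplectic algebra; the two products differ by a term that is
  complex bilinear and symmetric, and the second one has curvature. The family parameter scales
  the metric. Rescaling cannot be undone by an automorphism because the algebra has no compatible
  dilations: the third power of \<open>D\<close> makes \<open>\<Omega>\<close> scale by \<open>\<mu>\<^sup>5\<close>, other invariant tensors make it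
  scale by \<open>\<mu>\<^sup>4\<close>. The flat product provides a simply transitive affine action, that is, a polynomial
  group law whose integer points form a lattice, and the geodesic equations are triangular, hence
  solvable for all times.
\<close>

section \<open>Polynomial maps are smooth\<close>

text \<open>The derivative is taken direction by direction because \<open>Ck_on\<close> recurses on
  \<open>\<lambda>x. f' x v\<close>: each directional derivative is again polynomial, so the
  recursion never leaves polynomials.\<close>

lemma real_polynomial_function_has_derivative:
  assumes "real_polynomial_function p"
  shows "\<exists>p'. (\<forall>x. (p has_derivative p' x) (at x)) \<and> (\<forall>v. real_polynomial_function (\<lambda>x. p' x v))"
  using assms
proof (induction p)
  case (linear f)
  then have "(f has_derivative f) (at x)" for x
    by (rule bounded_linear_imp_has_derivative)
  then show ?case
    by (intro exI[of _ "\<lambda>_. f"]) auto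
next
  case (const c)
  show ?case
    by (intro exI[of _ "\<lambda>_ _. 0"]) auto
next
  case (add f g)
  then obtain f' g' where "\<And>x. (f has_derivative f' x) (at x)" "\<And>x. (g has_derivative g' x) (at x)"
    "\<And>v. real_polynomial_function (\<lambda>x. f' x v)" "\<And>v. real_polynomial_function (\<lambda>x. g' x v)"
    by blast
  then show ?case
    by (intro exI[of _ "\<lambda>x v. f' x v + g' x v"]) (auto intro!: has_derivative_add)
next
  case (mult f g)
  then obtain f' g' where *: "\<And>x. (f has_derivative f' x) (at x)" "\<And>x. (g has_derivative g' x) (at x)"
    "\<And>v. real_polynomial_function (\<lambda>x. f' x v)" "\<And>v. real_polynomial_function (\<lambda>x. g' x v)"
    by blast
  have "((\<lambda>x. f x * g x) has_derivative (\<lambda>v. f x * g' x v + f' x v * g x)) (at x)" for x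
    by (rule has_derivative_mult[OF *(1,2)])
  then show ?case
    using * mult.hyps
    by (intro exI[of _ "\<lambda>x v. f x * g' x v + f' x v * g x"] conjI allI
        real_polynomial_function.intros(3,4)) auto
qed

lemma polynomial_function_has_derivative:
  fixes f :: "'a::real_normed_vector \<Rightarrow> 'b::euclidean_space"
  assumes "polynomial_function f"
  shows "\<exists>f'. (\<forall>x. (f has_derivative f' x) (at x)) \<and> (\<forall>v. polynomial_function (\<lambda>x. f' x v))"
proof -
  have "real_polynomial_function (\<lambda>x. f x \<bullet> b)" for b
    using assms bounded_linear_inner_left unfolding polynomial_function_def comp_def by blast
  then have "\<exists>p'. (\<forall>x. ((\<lambda>x. f x \<bullet> b) has_derivative p' x) (at x)) \<and>
      (\<forall>v. real_polynomial_function (\<lambda>x. p' x v))" for b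
    by (rule real_polynomial_function_has_derivative)
  then obtain p' where p': "\<And>b x. ((\<lambda>x. f x \<bullet> b) has_derivative p' b x) (at x)"
    and poly: "\<And>b v. real_polynomial_function (\<lambda>x. p' b x v)"
    by metis
  define f' where "f' x v = (\<Sum>b\<in>Basis. p' b x v *\<^sub>R b)" for x v
  have "(f has_derivative f' x) (at x)" for x
    using p' by (subst has_derivative_componentwise_within) (auto simp: f'_def inner_sum_left_Basis)
  moreover have "polynomial_function (\<lambda>x. f' x v)" for v
    unfolding f'_def using poly
    by (intro polynomial_function_sum polynomial_function_mult)
       (auto simp flip: real_polynomial_function_eq)
  ultimately show ?thesis
    by blast
qed

lemma polynomial_function_smooth_on:
  fixes f :: "'a::real_normed_vector \<Rightarrow> 'b::euclidean_space"
  assumes "polynomial_function f"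
  shows "smooth_on S f"
proof -
  have "Ck_on k S f" for k
    using assms
  proof (induction k arbitrary: f)
    case 0
    then show ?case
      by (simp add: continuous_on_polymonial_function)
  next
    case (Suc k)
    then show ?case
      using polynomial_function_has_derivative[OF Suc.prems] by auto
  qed
  then show ?thesis
    by (simp add: smooth_on_def)
qed


section \<open>Triangular ordinary differential equations\<close>

text \<open>
  Triangularity means that the first \<open>k\<close> components of the solution determine the first \<open>k + 1\<close>
  components of the right-hand side. Picard iteration then becomes stationary after finitely many
  steps, so no growth condition on \<open>F\<close> is needed.
\<close>
lemma triangular_ode_solution:
  fixes F :: "real \<Rightarrow> 'a::euclidean_space \<Rightarrow> 'a" and \<pi> :: "nat \<Rightarrow> 'a \<Rightarrow> 'a"
  assumes cont: "continuous_on UNIV (\<lambda>(t, y). F t y)"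
    and lin: "\<And>k. linear (\<pi> k)"
    and start: "\<And>y. \<pi> 0 y = 0"
    and final: "\<And>y. \<pi> K y = y"
    and step: "\<And>k t y z. \<pi> k y = \<pi> k z \<Longrightarrow> \<pi> (Suc k) (F t y) = \<pi> (Suc k) (F t z)"
  shows "\<exists>y. y 0 = y0 \<and> (\<forall>t. (y has_vector_derivative F t (y t)) (at t))"
proof -
  have antiderivative: "\<exists>Y. Y 0 = y0 \<and> (\<forall>t. (Y has_vector_derivative f t) (at t))"
    if "continuous_on UNIV f" for f :: "real \<Rightarrow> 'a"
  proof -
    have "\<exists>Y. \<forall>t. (Y has_vector_derivative f t) (at t)"
      using einterval_antiderivative[of "-\<infinity>" \<infinity> f] that
      by (simp add: continuous_on_eq_continuous_at)
    then obtain Y where Y: "\<And>t. (Y has_vector_derivative f t) (at t)"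
      by blast
    show ?thesis
      by (intro exI[of _ "\<lambda>t. Y t - Y 0 + y0"])
         (auto intro!: derivative_eq_intros Y)
  qed
  have contF: "continuous_on UNIV (\<lambda>t. F t (Y t))" if "continuous_on UNIV Y" for Y
    using continuous_on_compose2[OF cont, of UNIV "\<lambda>t. (t, Y t)"] that
    by (simp add: continuous_on_Pair continuous_on_id)
  have cont_of_deriv: "continuous_on UNIV Y" if "\<forall>t. (Y has_vector_derivative f t) (at t)"
    for Y and f :: "real \<Rightarrow> 'a"
    using that by (meson continuous_on_vector_derivative has_vector_derivative_at_within)
  have "\<exists>Y. \<forall>k. (Y k 0 = y0 \<and> continuous_on UNIV (Y k)) \<and>
        (\<forall>t. (Y (Suc k) has_vector_derivative F t (Y k t)) (at t))"
  proof (rule dependent_nat_choice)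
    show "\<exists>x::real \<Rightarrow> 'a. x 0 = y0 \<and> continuous_on UNIV x"
      by (rule exI[of _ "\<lambda>_. y0"]) simp
  next
    fix x :: "real \<Rightarrow> 'a" and k :: nat
    assume "x 0 = y0 \<and> continuous_on UNIV x"
    then obtain y where "y 0 = y0" and y: "\<forall>t. (y has_vector_derivative F t (x t)) (at t)"
      using antiderivative[OF contF, of x] by blast
    then show "\<exists>y. (y 0 = y0 \<and> continuous_on UNIV y) \<and>
        (\<forall>t. (y has_vector_derivative F t (x t)) (at t))"
      using cont_of_deriv[OF y] by blast
  qed
  then obtain Y where Y0: "\<And>k. Y k 0 = y0"
    and Y': "\<And>k t. (Y (Suc k) has_vector_derivative F t (Y k t)) (at t)"
    by blast
  have stationary: "\<pi> k (Y k t) = \<pi> k (Y (Suc k) t)" for k t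
  proof (induction k arbitrary: t)
    case 0
    show ?case
      by (simp add: start)
  next
    case (Suc k)
    \<comment> \<open>Consecutive iterates both start at \<open>y0\<close>, so it is enough that the
      difference of their first \<open>k + 1\<close> components has zero derivative.\<close>
    let ?d = "\<lambda>t. \<pi> (Suc k) (Y (Suc k) t) - \<pi> (Suc k) (Y (Suc (Suc k)) t)"
    have "(?d has_vector_derivative
        \<pi> (Suc k) (F t (Y k t)) - \<pi> (Suc k) (F t (Y (Suc k) t))) (at t)" for t
      using bounded_linear.has_vector_derivative[OF linear_conv_bounded_linear[THEN iffD1, OF lin] Y']
      by (intro has_vector_derivative_diff)
    moreover have "\<pi> (Suc k) (F t (Y k t)) - \<pi> (Suc k) (F t (Y (Suc k) t)) = 0" for t
      using step[OF Suc.IH] by simp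
    ultimately have "(?d has_vector_derivative 0) (at t)" for t
      by simp
    then obtain c where "\<And>t. ?d t = c"
      using has_vector_derivative_zero_constant[of UNIV ?d] by auto
    then have "?d t = ?d 0"
      by metis
    then show ?case
      by (simp add: Y0)
  qed
  \<comment> \<open>\<open>\<pi> K\<close> is the identity, so \<open>Y K\<close> equals its own
    Picard successor and solves the equation.\<close>
  have "Y (Suc K) = Y K"
    using stationary[of K] final by auto
  then show ?thesis
    using Y0 Y'[of K] by metis
qed


section \<open>Quotient topologies\<close>

text \<open>\<open>lattice_in\<close> asks for the quotient topology as an object. It is the final
  topology on the image.\<close>

lemma quotient_map_exists: "\<exists>Q. quotient_map X Q f"
proof -
  define L where "L U \<longleftrightarrow> U \<subseteq> f ` topspace X \<and> openin X {x \<in> topspace X. f x \<in> U}" for U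
  have "L (U \<inter> V)" if "L U" "L V" for U V
  proof -
    have "{x \<in> topspace X. f x \<in> U \<inter> V} = {x \<in> topspace X. f x \<in> U} \<inter> {x \<in> topspace X. f x \<in> V}"
      by blast
    then show ?thesis
      using that unfolding L_def by (auto intro: openin_Int)
  qed
  moreover have "L (\<Union>\<U>)" if "\<And>U. U \<in> \<U> \<Longrightarrow> L U" for \<U>
  proof -
    have "{x \<in> topspace X. f x \<in> \<Union>\<U>} = (\<Union>U\<in>\<U>. {x \<in> topspace X. f x \<in> U})"
      by blast
    then show ?thesis
      using that unfolding L_def by (intro conjI) (blast, auto)
  qed
  ultimately have "istopology L"
    by (simp add: istopology_def)
  then have open_iff: "openin (topology L) U \<longleftrightarrow> L U" for U
    by (simp add: topology_inverse')
  have "{x \<in> topspace X. f x \<in> f ` topspace X} = topspace X"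
    by blast
  then have "L (f ` topspace X)"
    by (simp add: L_def)
  then have "topspace (topology L) = f ` topspace X"
    unfolding topspace_def[of "topology L"] open_iff by (auto simp: L_def)
  then have "quotient_map X (topology L) f"
    by (auto simp: quotient_map_def open_iff L_def)
  then show ?thesis ..
qed


section \<open>Hypersymplectic structures from parallel tensors\<close>

text \<open>The difference of two such products is symmetric in its arguments, while its pairing
  with a third vector is skew in the last two. Alternating these exchanges six times returns the
  same expression with the opposite sign.\<close>

lemma levi_civita_unique:
  assumes g: "metric g" and D: "is_levi_civita br g D" and D': "is_levi_civita br g D'"
  shows "D = D'"
proof (intro ext)
  fix X Y
  have bil: "bilinear g" and nondeg: "\<And>X. (\<And>Y. g X Y = 0) \<Longrightarrow> X = 0" and sym: "\<And>X Y. g X Y = g Y X"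
    using g by (auto simp: metric_def)
  define S where "S X Y = D X Y - D' X Y" for X Y
  have S_sym: "S X Y = S Y X" for X Y
  proof -
    have "D X Y - D Y X = D' X Y - D' Y X"
      using D D' by (simp add: is_levi_civita_def)
    then show ?thesis
      by (simp add: S_def algebra_simps)
  qed
  have S_skew: "g (S X Y) Z = - g (S X Z) Y" for X Y Z
  proof -
    have "g (D X Y) Z + g Y (D X Z) = 0" "g (D' X Y) Z + g Y (D' X Z) = 0"
      using D D' by (auto simp: is_levi_civita_def)
    then show ?thesis
      using sym[of Y] by (simp add: S_def bilinear_lsub[OF bil])
  qed
  have "g (S X Y) Z = 0" for Z
    using S_skew[of X Y Z] S_skew[of Z X Y] S_skew[of Y Z X] S_sym[of X Z] S_sym[of Z Y] S_sym[of Y X]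
    by simp
  then have "S X Y = 0"
    by (rule nondeg)
  then show "D X Y = D' X Y"
    by (simp add: S_def)
qed

lemma levi_civita_eq:
  assumes "metric g" and "is_levi_civita br g D"
  shows "levi_civita br g = D"
  unfolding levi_civita_def using assms levi_civita_unique by blast

text \<open>Writing every bracket as \<open>D X Y - D Y X\<close> makes the Nijenhuis expression of
  a parallel endomorphism cancel term by term; closedness of the 2-form follows in the same
  manner.\<close>

lemma hypersymplectic_if_parallel:
  fixes D :: "'a::euclidean_space \<Rightarrow> 'a \<Rightarrow> 'a"
  assumes lin: "linear J" "linear E"
    and J: "\<And>X. J (J X) = - X" and E: "\<And>X. E (E X) = X" and JE: "\<And>X. J (E X) = - E (J X)"
    and DJ: "\<And>X Y. D X (J Y) = J (D X Y)" and DE: "\<And>X Y. D X (E Y) = E (D X Y)"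
    and g: "metric g" and gJ: "\<And>X Y. g (J X) (J Y) = g X Y" and gE: "\<And>X Y. g (E X) (E Y) = - g X Y"
    and LC: "is_levi_civita br g D"
  shows "hypersymplectic br J E g"
proof -
  have bil: "bilinear g" and sym: "\<And>X Y. g X Y = g Y X"
    using g by (auto simp: metric_def)
  have br: "br X Y = D X Y - D Y X" for X Y
    using LC by (simp add: is_levi_civita_def)
  have skew: "g (D X Y) Z = - g Y (D X Z)" for X Y Z
    using LC by (simp add: is_levi_civita_def eq_neg_iff_add_eq_0)
  have parallel_integrable: "integrable_endo br A"
    if "linear A" "\<And>X Y. D X (A Y) = A (D X Y)" for A
    using that by (simp add: integrable_endo_def nijenhuis_def br linear_diff)
  obtain b :: 'a where "b \<noteq> 0"
    using nonempty_Basis nonzero_Basis by blast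
  \<comment> \<open>Plus or minus the identity commutes with \<open>J\<close>; anticommuting as well
    would force \<open>J\<close> to vanish.\<close>
  moreover have "X = 0" if "E = id \<or> E = (\<lambda>X. - X)" for X :: 'a
  proof -
    have "J X = - J X"
      using that JE[of X] linear_neg[OF lin(1)] by auto
    then have "2 *\<^sub>R J X = 0"
      by (simp add: scaleR_2 eq_neg_iff_add_eq_0)
    then have "J X = 0"
      by simp
    then show ?thesis
      using J[of X] linear_0[OF lin(1)] by simp
  qed
  ultimately have "E \<noteq> id" "E \<noteq> (\<lambda>X. - X)"
    by blast+
  moreover have "ce_diff2 br (\<lambda>U V. g (J U) V) X Y Z = 0" for X Y Z
  proof -
    \<comment> \<open>\<open>J\<close> and \<open>D X\<close> are skew for \<open>g\<close> and
      commute, so their composite is self-adjoint; the six terms of the differential then cancel in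
      pairs.\<close>
    have "g (J (D X Y)) Z = g (J (D X Z)) Y" for X Y Z
    proof -
      have "g (J (D X Y)) Z = - g (J Y) (D X Z)"
        using skew DJ by metis
      also have "\<dots> = g (J Y) (J (J (D X Z)))"
        by (simp add: J bilinear_rneg[OF bil])
      finally show ?thesis
        using gJ sym by metis
    qed
    then show ?thesis
      by (simp add: ce_diff2_def br linear_diff[OF lin(1)] bilinear_lsub[OF bil])
  qed
  ultimately show ?thesis
    using assms parallel_integrable
    by (auto simp: hypersymplectic_def complex_structure_def product_structure_def fun_eq_iff)
qed

text \<open>By uniqueness, equivalences also intertwine the Levi-Civita products.\<close>
lemma lie_automorphism_levi_civita:
  assumes \<psi>: "lie_automorphism br \<psi>" and isom: "\<And>X Y. g' (\<psi> X) (\<psi> Y) = g X Y"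
    and g: "metric g" and LC: "is_levi_civita br g D" and LC': "is_levi_civita br g' D'"
  shows "\<psi> (D X Y) = D' (\<psi> X) (\<psi> Y)"
proof -
  have lin: "linear \<psi>" and "bij \<psi>" and br: "\<And>X Y. \<psi> (br X Y) = br (\<psi> X) (\<psi> Y)"
    using \<psi> by (auto simp: lie_automorphism_def)
  define \<phi> where "\<phi> = inv_into UNIV \<psi>"
  have \<psi>\<phi>: "\<psi> (\<phi> X) = X" and \<phi>\<psi>: "\<phi> (\<psi> X) = X" for X
    using \<open>bij \<psi>\<close> by (simp_all add: \<phi>_def bij_is_surj surj_f_inv_f bij_is_inj)
  have lin\<phi>: "linear \<phi>"
  proof (rule linearI)
    show "\<phi> (X + Y) = \<phi> X + \<phi> Y" for X Y
      using \<phi>\<psi>[of "\<phi> X + \<phi> Y"] by (simp add: linear_add[OF lin] \<psi>\<phi>)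
    show "\<phi> (r *\<^sub>R X) = r *\<^sub>R \<phi> X" for r X
      using \<phi>\<psi>[of "r *\<^sub>R \<phi> X"] by (simp add: linear_scale[OF lin] \<psi>\<phi>)
  qed
  define D'' where "D'' X Y = \<phi> (D' (\<psi> X) (\<psi> Y))" for X Y
  have "is_levi_civita br g D''"
    unfolding is_levi_civita_def
  proof (intro conjI allI)
    have "bilinear D'"
      using LC' by (simp add: is_levi_civita_def)
    then have "linear (\<lambda>Y. D' (\<psi> X) (\<psi> Y))" "linear (\<lambda>X. D' (\<psi> X) (\<psi> Y))" for X Y
      unfolding bilinear_def using linear_compose[OF lin] by (auto simp: comp_def)
    then show "bilinear D''"
      unfolding bilinear_def D''_def using linear_compose[OF _ lin\<phi>] by (auto simp: comp_def)
  next
    fix X Y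
    have "D'' X Y - D'' Y X = \<phi> (D' (\<psi> X) (\<psi> Y) - D' (\<psi> Y) (\<psi> X))"
      by (simp add: D''_def linear_diff[OF lin\<phi>])
    also have "\<dots> = \<phi> (\<psi> (br X Y))"
      using LC' br by (simp add: is_levi_civita_def)
    finally show "D'' X Y - D'' Y X = br X Y"
      by (simp add: \<phi>\<psi>)
  next
    fix X Y Z
    have "g' (D' (\<psi> X) (\<psi> Y)) (\<psi> Z) + g' (\<psi> Y) (D' (\<psi> X) (\<psi> Z)) = 0"
      using LC' by (simp add: is_levi_civita_def)
    then show "g (D'' X Y) Z + g Y (D'' X Z) = 0"
      by (simp add: D''_def \<psi>\<phi> flip: isom)
  qed
  then have "D = D''"
    using levi_civita_unique[OF g LC] by blast
  then show ?thesis
    by (simp add: D''_def \<psi>\<phi>)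
qed


section \<open>Complex coordinates\<close>

text \<open>The type is known only by its dimension; an arbitrary enumeration of
  \<open>Basis\<close> lets consecutive pairs serve as real and imaginary parts.\<close>

definition onb :: "nat \<Rightarrow> 'a::euclidean_space"
  where "onb = (SOME b. bij_betw b {..<DIM('a)} Basis)"

definition coord :: "'a::euclidean_space \<Rightarrow> nat \<Rightarrow> complex"
  where "coord x j = Complex (x \<bullet> onb (2 * j)) (x \<bullet> onb (2 * j + 1))"

definition vec_of :: "(nat \<Rightarrow> complex) \<Rightarrow> 'a::euclidean_space"
  where "vec_of z =
    (\<Sum>j<DIM('a) div 2. Re (z j) *\<^sub>R onb (2 * j) + Im (z j) *\<^sub>R onb (2 * j + 1))"

text \<open>All brackets live in the first four complex coordinates. The remaining ones span an
  abelian factor, so one algebra of real dimension 8 serves every \<open>n\<close>.\<close>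

definition first_four :: "complex \<Rightarrow> complex \<Rightarrow> complex \<Rightarrow> complex \<Rightarrow> nat \<Rightarrow> complex"
  where "first_four a b c d j =
    (if j = 0 then a else if j = 1 then b else if j = 2 then c else if j = 3 then d else 0)"

lemma first_four_simps [simp]:
  "first_four a b c d 0 = a" "first_four a b c d 1 = b" "first_four a b c d (Suc 0) = b"
  "first_four a b c d 2 = c" "first_four a b c d 3 = d" "4 \<le> j \<Longrightarrow> first_four a b c d j = 0"
  by (auto simp: first_four_def)

lemma bij_betw_onb: "bij_betw onb {..<DIM('a)} (Basis :: 'a::euclidean_space set)"
  unfolding onb_def using ex_bij_betw_nat_finite[of "Basis :: 'a set"]
  by (intro someI_ex[of "\<lambda>b. bij_betw b {..<DIM('a)} Basis"]) (auto simp: atLeast0LessThan)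

lemma inner_onb:
  assumes "i < DIM('a)" "j < DIM('a)"
  shows "(onb i :: 'a::euclidean_space) \<bullet> onb j = (if i = j then 1 else 0)"
proof -
  have inj: "inj_on (onb :: nat \<Rightarrow> 'a) {..<DIM('a)}" and "onb ` {..<DIM('a)} = (Basis :: 'a set)"
    using bij_betw_onb[where 'a='a] by (simp_all add: bij_betw_def)
  then have "onb i \<in> (Basis :: 'a set)" "onb j \<in> (Basis :: 'a set)"
    using assms by auto
  then show ?thesis
    using inj_on_eq_iff[OF inj, of i j] assms by (simp add: inner_Basis)
qed

lemma coord_simps [simp]:
  "coord 0 j = 0" "coord (x + y) j = coord x j + coord y j"
  "coord (x - y) j = coord x j - coord y j" "coord (- x) j = - coord x j"
  "coord (r *\<^sub>R x) j = of_real r * coord x j"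
  by (auto simp: coord_def complex_eq_iff inner_add_left inner_diff_left)

section \<open>The symplectic form, the two conjugations and the two connections\<close>

definition Omega :: "'a::euclidean_space \<Rightarrow> 'a \<Rightarrow> complex"
  where "Omega u v =
    (\<Sum>k<DIM('a) div 4. coord u (2 * k) * coord v (2 * k + 1) - coord u (2 * k + 1) * coord v (2 * k))"

definition cstruct :: "'a::euclidean_space \<Rightarrow> 'a"
  where "cstruct x = vec_of (\<lambda>j. \<i> * coord x j)"

definition conj_flat :: "'a::euclidean_space \<Rightarrow> 'a"
  where "conj_flat x = vec_of (\<lambda>j. cnj (coord x j))"

text \<open>Complex conjugation followed by \<open>1 + N\<close>, where \<open>N\<close> takes
  coordinate 2 to coordinate 0 with factor \<open>\<i> / 3\<close> and coordinate 1 to coordinate 3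
  with factor \<open>- \<i> / 3\<close>. \<open>N\<close> squares to zero, so \<open>1 + N\<close>
  is its exponential; \<open>N\<close> is imaginary, so \<open>(1 + N) (1 - N) = 1\<close> makes the
  composite an involution.\<close>

definition conj_curved :: "'a::euclidean_space \<Rightarrow> 'a"
  where "conj_curved x = vec_of (\<lambda>j. cnj (coord x j) +
    first_four (\<i> / 3 * cnj (coord x 2)) 0 0 (- (\<i> / 3) * cnj (coord x 1)) j)"

text \<open>The entry of \<open>conn_flat u\<close> from coordinate 3 to 0 and from coordinate 1 to
  2; being infinitesimally symplectic forces these two to agree.\<close>

definition off_diag :: "'a::euclidean_space \<Rightarrow> real"
  where "off_diag u = 6 * Re (coord u 3) + 2 * Im (coord u 1)"

text \<open>
  The flat product takes values in nilpotent matrices that lower the flag with successive quotients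
  spanned by the coordinates 1, 3, 2, 0 and are symplectic for the pairs (0, 1) and (2, 3).
\<close>
definition conn_flat :: "'a::euclidean_space \<Rightarrow> 'a \<Rightarrow> 'a"
  where "conn_flat u v = vec_of (first_four
    (- Re (coord u 1) * coord v 2 + off_diag u * coord v 3
      - (2 * Re (coord u 2) + 8 * Im (coord u 3)) * coord v 1)
    0
    (12 * Re (coord u 1) * coord v 3 + off_diag u * coord v 1)
    (Re (coord u 1) * coord v 1))"

text \<open>The correction is symmetric, so it does not change the bracket.\<close>
definition conn_curved :: "'a::euclidean_space \<Rightarrow> 'a \<Rightarrow> 'a"
  where "conn_curved u v = conn_flat u v + vec_of (first_four
    (2 * \<i> * (coord u 1 * coord v 3 + coord u 3 * coord v 1)) 0 (2 * \<i> * coord u 1 * coord v 1) 0)"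

definition bracket :: "'a::euclidean_space \<Rightarrow> 'a \<Rightarrow> 'a"
  where "bracket u v = conn_flat u v - conn_flat v u"

definition herm :: "('a::euclidean_space \<Rightarrow> 'a) \<Rightarrow> real \<Rightarrow> 'a \<Rightarrow> 'a \<Rightarrow> real"
  where "herm E c u v = c * Im (Omega u (E v))"

section \<open>Coordinate calculus in real dimension \<open>4 * n\<close>\<close>

locale quaternionic_dimension =
  fixes n :: nat and ty :: "'a::euclidean_space itself"
  assumes dim: "DIM('a) = 4 * n" and n_ge_2: "2 \<le> n"
begin

lemma coord_vec_of:
  assumes "j < 2 * n"
  shows "coord (vec_of z :: 'a) j = z j"
proof -
  have less: "2 * i < DIM('a)" "Suc (2 * i) < DIM('a)" if "i < 2 * n" for i
    using that dim by auto
  have half: "DIM('a) div 2 = 2 * n"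
    using dim by simp
  have "2 * i \<noteq> Suc (2 * j)" "Suc (2 * i) \<noteq> 2 * j" for i
    by presburger+
  then have "(vec_of z :: 'a) \<bullet> onb (2 * j) = (\<Sum>i<2 * n. Re (z i) * (if i = j then 1 else 0))"
    "(vec_of z :: 'a) \<bullet> onb (2 * j + 1) = (\<Sum>i<2 * n. Im (z i) * (if i = j then 1 else 0))"
    unfolding vec_of_def inner_sum_left half using assms less
    by (auto intro!: sum.cong simp: inner_add_left inner_onb)
  then show ?thesis
    using assms by (simp add: coord_def complex_eq_iff if_distrib cong: if_cong)
qed

lemma coord_vec_of_simps [simp]:
  "coord (vec_of z :: 'a) 0 = z 0" "coord (vec_of z :: 'a) 1 = z 1"
  "coord (vec_of z :: 'a) (Suc 0) = z 1"
  "coord (vec_of z :: 'a) 2 = z 2" "coord (vec_of z :: 'a) 3 = z 3"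
  using n_ge_2 by (auto simp: coord_vec_of)

lemma coord_eqI_all:
  fixes x y :: 'a
  assumes "\<And>j. j < 2 * n \<Longrightarrow> coord x j = coord y j"
  shows "x = y"
proof (rule euclidean_eqI)
  fix b :: 'a
  assume "b \<in> Basis"
  then obtain i where i: "i < 4 * n" "b = onb i"
    using bij_betw_onb[where 'a='a] dim unfolding bij_betw_def by auto
  have "coord x (i div 2) = coord y (i div 2)"
    using i by (intro assms) auto
  then have "x \<bullet> onb (2 * (i div 2)) = y \<bullet> onb (2 * (i div 2))"
    "x \<bullet> onb (2 * (i div 2) + 1) = y \<bullet> onb (2 * (i div 2) + 1)"
    by (auto simp: coord_def)
  moreover have "i = 2 * (i div 2) \<or> i = 2 * (i div 2) + 1"
    by presburger
  ultimately show "x \<bullet> b = y \<bullet> b"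
    using i by metis
qed

lemma coord_eqI:
  fixes x y :: 'a
  assumes "coord x 0 = coord y 0" "coord x 1 = coord y 1" "coord x 2 = coord y 2"
    "coord x 3 = coord y 3" "\<And>j. 4 \<le> j \<Longrightarrow> j < 2 * n \<Longrightarrow> coord x j = coord y j"
  shows "x = y"
proof (rule coord_eqI_all)
  fix j assume "j < 2 * n"
  moreover have "j = 0 \<or> j = 1 \<or> j = 2 \<or> j = 3 \<or> 4 \<le> j"
    by linarith
  ultimately show "coord x j = coord y j"
    using assms by auto
qed

lemma vec_of_coord [simp]: "vec_of (coord x) = (x :: 'a)"
  by (rule coord_eqI_all) (simp add: coord_vec_of)

lemma Omega_split: "Omega (u :: 'a) v =
    coord u 0 * coord v 1 - coord u 1 * coord v 0 + (coord u 2 * coord v 3 - coord u 3 * coord v 2) +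
    (\<Sum>k\<in>{2..<n}. coord u (2 * k) * coord v (2 * k + 1) - coord u (2 * k + 1) * coord v (2 * k))"
proof -
  have "{..<n} = insert 0 (insert 1 {2..<n})"
    using n_ge_2 by auto
  moreover have "DIM('a) div 4 = n"
    using dim by simp
  ultimately show ?thesis
    by (simp add: Omega_def numeral_2_eq_2 numeral_3_eq_3)
qed

lemma Omega_swap: "Omega v u = - Omega u (v :: 'a)"
  by (simp add: Omega_def algebra_simps flip: sum_negf)

lemma Omega_simps:
  "Omega (u + u') v = Omega u v + Omega u' (v :: 'a)" "Omega u (v + v') = Omega u v + Omega u (v' :: 'a)"
  "Omega (r *\<^sub>R u) v = of_real r * Omega u v" "Omega u (r *\<^sub>R v) = of_real r * Omega u v"
  by (simp_all add: Omega_def algebra_simps sum_distrib_left sum.distrib sum_subtractf)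

lemma Omega_cstruct [simp]:
  "Omega (cstruct u) v = \<i> * Omega u (v :: 'a)" "Omega u (cstruct v) = \<i> * Omega u (v :: 'a)"
  unfolding Omega_split cstruct_def
  by (simp_all add: algebra_simps sum_distrib_left sum_subtractf coord_vec_of)

lemma Omega_nondegenerate:
  assumes "\<And>v. Omega u v = 0"
  shows "u = (0 :: 'a)"
proof (rule coord_eqI_all)
  fix j assume j: "j < 2 * n"
  have dim4: "DIM('a) div 4 = n"
    using dim by simp
  define k where "k = j div 2"
  have k: "k < n" and jk: "j = 2 * k \<or> j = 2 * k + 1"
    using j unfolding k_def by auto
  have neq: "2 * i \<noteq> Suc (2 * k)" "Suc (2 * i) \<noteq> 2 * k" for i
    by presburger+
  have "Omega u (vec_of (\<lambda>i. if i = 2 * k + 1 then 1 else 0)) = (\<Sum>i<n. if i = k then coord u (2 * k) else 0)"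
    unfolding Omega_def dim4 using neq by (intro sum.cong refl) (auto simp: coord_vec_of)
  moreover have "Omega u (vec_of (\<lambda>i. if i = 2 * k then 1 else 0)) = (\<Sum>i<n. if i = k then - coord u (2 * k + 1) else 0)"
    unfolding Omega_def dim4 using neq by (intro sum.cong refl) (auto simp: coord_vec_of)
  ultimately show "coord u j = coord 0 j"
    using assms jk k by auto
qed

lemma coord_conn_flat [simp]:
  "coord (conn_flat u v :: 'a) 0 = - Re (coord u 1) * coord v 2 + off_diag u * coord v 3
      - (2 * Re (coord u 2) + 8 * Im (coord u 3)) * coord v 1"
  "coord (conn_flat u v :: 'a) 1 = 0"
  "coord (conn_flat u v :: 'a) (Suc 0) = 0"
  "coord (conn_flat u v :: 'a) 2 = 12 * Re (coord u 1) * coord v 3 + off_diag u * coord v 1"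
  "coord (conn_flat u v :: 'a) 3 = Re (coord u 1) * coord v 1"
  "4 \<le> j \<Longrightarrow> j < 2 * n \<Longrightarrow> coord (conn_flat u v :: 'a) j = 0"
  by (simp_all add: conn_flat_def coord_vec_of)

lemma coord_conn_curved [simp]:
  "coord (conn_curved u v :: 'a) 0 = coord (conn_flat u v) 0 + 2 * \<i> * (coord u 1 * coord v 3 + coord u 3 * coord v 1)"
  "coord (conn_curved u v :: 'a) 1 = 0"
  "coord (conn_curved u v :: 'a) (Suc 0) = 0"
  "coord (conn_curved u v :: 'a) 2 = coord (conn_flat u v) 2 + 2 * \<i> * coord u 1 * coord v 1"
  "coord (conn_curved u v :: 'a) 3 = Re (coord u 1) * coord v 1"
  "4 \<le> j \<Longrightarrow> j < 2 * n \<Longrightarrow> coord (conn_curved u v :: 'a) j = 0"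
  by (simp_all add: conn_curved_def coord_vec_of)

lemma coord_struct_simps [simp]:
  "coord (cstruct x :: 'a) 0 = \<i> * coord x 0" "coord (cstruct x :: 'a) 1 = \<i> * coord x 1"
  "coord (cstruct x :: 'a) (Suc 0) = \<i> * coord x 1"
  "coord (cstruct x :: 'a) 2 = \<i> * coord x 2" "coord (cstruct x :: 'a) 3 = \<i> * coord x 3"
  "coord (conj_flat x :: 'a) 0 = cnj (coord x 0)" "coord (conj_flat x :: 'a) 1 = cnj (coord x 1)"
  "coord (conj_flat x :: 'a) (Suc 0) = cnj (coord x 1)"
  "coord (conj_flat x :: 'a) 2 = cnj (coord x 2)" "coord (conj_flat x :: 'a) 3 = cnj (coord x 3)"
  "coord (conj_curved x :: 'a) 0 = cnj (coord x 0) + \<i> / 3 * cnj (coord x 2)"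
  "coord (conj_curved x :: 'a) 1 = cnj (coord x 1)" "coord (conj_curved x :: 'a) (Suc 0) = cnj (coord x 1)"
  "coord (conj_curved x :: 'a) 2 = cnj (coord x 2)"
  "coord (conj_curved x :: 'a) 3 = cnj (coord x 3) - \<i> / 3 * cnj (coord x 1)"
  by (simp_all add: cstruct_def conj_flat_def conj_curved_def)

lemma coord_struct_ge_4 [simp]:
  assumes "4 \<le> j" "j < 2 * n"
  shows "coord (cstruct x :: 'a) j = \<i> * coord x j" "coord (conj_flat x :: 'a) j = cnj (coord x j)"
    "coord (conj_curved x :: 'a) j = cnj (coord x j)"
  using assms by (simp_all add: cstruct_def conj_flat_def conj_curved_def coord_vec_of)

lemma off_diag_simps [simp]:
  "off_diag (u + v :: 'a) = off_diag u + off_diag v" "off_diag (u - v :: 'a) = off_diag u - off_diag v"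
  "off_diag (- u :: 'a) = - off_diag u" "off_diag (r *\<^sub>R u :: 'a) = r * off_diag u"
  "off_diag (conn_flat u v :: 'a) = 6 * Re (coord u 1) * Re (coord v 1)"
  "off_diag (conn_curved u v :: 'a) = 6 * Re (coord u 1) * Re (coord v 1)"
  by (simp_all add: off_diag_def algebra_simps)

lemma linear_structs: "linear (cstruct :: 'a \<Rightarrow> 'a)" "linear (conj_flat :: 'a \<Rightarrow> 'a)"
    "linear (conj_curved :: 'a \<Rightarrow> 'a)"
  by ((rule linearI; rule coord_eqI; simp add: algebra_simps)+)

lemma bilinear_conn: "bilinear (conn_flat :: 'a \<Rightarrow> 'a \<Rightarrow> 'a)" "bilinear (conn_curved :: 'a \<Rightarrow> 'a \<Rightarrow> 'a)"
  unfolding bilinear_def by (auto intro!: linearI coord_eqI simp: algebra_simps complex_eq_iff)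

lemma cstruct_cstruct: "cstruct (cstruct x) = - (x :: 'a)"
  by (rule coord_eqI) (simp_all add: algebra_simps flip: mult.assoc)

end


section \<open>Two hypersymplectic structures with the same Lie bracket\<close>

text \<open>What both structures share, so that the metric, its Levi-Civita product and the scaling
  of equivalences are treated once. \<open>D_cubed\<close> is the invariant tensor from which the
  action of an equivalence on coordinate 1 is read off.\<close>

locale parallel_real_structure = quaternionic_dimension n ty
  for n :: nat and ty :: "'a::euclidean_space itself" +
  fixes E :: "'a \<Rightarrow> 'a" and D :: "'a \<Rightarrow> 'a \<Rightarrow> 'a"
  assumes linear_E: "linear E" and E_E: "\<And>u. E (E u) = u"
    and E_cstruct: "\<And>u. E (cstruct u) = - cstruct (E u)"
    and Omega_E_E: "\<And>u v. Omega (E u) (E v) = cnj (Omega u v)"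
    and bilinear_D: "bilinear D"
    and D_cstruct: "\<And>u v. D u (cstruct v) = cstruct (D u v)"
    and D_E: "\<And>u v. D u (E v) = E (D u v)"
    and Omega_D: "\<And>u v w. Omega (D u v) w + Omega v (D u w) = 0"
    and torsion_free: "\<And>u v. D u v - D v u = bracket u v"
    and D_cubed: "\<And>u v w. Omega (D u (D u (D u v))) w = - 12 * Re (coord u 1) ^ 3 * coord v 1 * coord w 1"
begin

lemma Omega_E: "Omega u (E v) = cnj (Omega (E u) v)"
  using Omega_E_E[of "E u" v] by (simp add: E_E)

text \<open>\<open>Omega\<close> is skew and \<open>E\<close> conjugates it, so
  \<open>Omega u (E v)\<close> is minus the conjugate of \<open>Omega v (E u)\<close>. This is why
  the imaginary part is the symmetric one.\<close>

lemma metric_herm: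
  assumes "c \<noteq> 0"
  shows "metric (herm E c)"
  unfolding metric_def
proof (intro conjI allI impI)
  show "bilinear (herm E c)"
    unfolding bilinear_def herm_def using linear_E
    by (auto intro!: linearI simp: Omega_simps linear_add linear_scale algebra_simps)
  show "herm E c u v = herm E c v u" for u v
    using Omega_E[of u v] Omega_swap[of v "E u"] by (simp add: herm_def)
next
  fix u assume *: "\<forall>v. herm E c u v = 0"
  have Im: "Im (Omega u v) = 0" for v
    using assms *[rule_format, of "E v"] by (simp add: herm_def E_E)
  \<comment> \<open>Replacing \<open>v\<close> by \<open>cstruct v\<close> turns the real part into
    an imaginary part.\<close>
  have "Omega u v = 0" for v
    using Im[of v] Im[of "cstruct v"] by (simp add: complex_eq_iff)
  then show "u = 0"
    by (rule Omega_nondegenerate)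
qed

lemma is_levi_civita_D: "is_levi_civita bracket (herm E c) D"
proof -
  have "herm E c (D u v) w + herm E c v (D u w) = 0" for u v w
  proof -
    have "Im (Omega (D u v) (E w)) + Im (Omega v (D u (E w))) = 0"
      by (simp flip: plus_complex.sel add: Omega_D)
    then show ?thesis
      by (simp add: herm_def D_E flip: distrib_left)
  qed
  then show ?thesis
    using bilinear_D torsion_free by (simp add: is_levi_civita_def)
qed

lemma levi_civita_D: "c \<noteq> 0 \<Longrightarrow> levi_civita bracket (herm E c) = D"
  by (intro levi_civita_eq metric_herm is_levi_civita_D)

lemma hypersymplectic_herm:
  assumes "c \<noteq> 0"
  shows "hypersymplectic bracket cstruct E (herm E c)"
proof (rule hypersymplectic_if_parallel[where D = D])
  have neg: "Omega u (- v) = - Omega u v" for u v :: 'a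
    using Omega_simps(4)[of u "-1" v] by simp
  show "herm E c (cstruct u) (cstruct v) = herm E c u v" for u v
    by (simp add: herm_def E_cstruct neg)
  show "herm E c (E u) (E v) = - herm E c u v" for u v
    using Omega_E[of u v] by (simp add: herm_def E_E)
  show "cstruct (E u) = - E (cstruct u)" for u
    by (simp add: E_cstruct)
qed (use assms in \<open>simp_all add: linear_structs linear_E cstruct_cstruct E_E D_cstruct D_E metric_herm is_levi_civita_D\<close>)

text \<open>An equivalence commutes with \<open>E\<close> and \<open>cstruct\<close>, so the
  isometry property scales first the imaginary part and then all of \<open>Omega\<close> by
  \<open>c / c'\<close>. Preserving the cubed product makes it multiply coordinate 1 by a real
  \<open>\<mu>\<close>, and the tensor in \<open>D_cubed\<close> has degree 5 in that
  coordinate.\<close>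

lemma equivalence_scales_Omega:
  assumes "equivalent_hypersymplectic bracket cstruct E (herm E c) cstruct E (herm E c')"
    and "c > 0" "c' > 0"
  obtains \<psi> \<mu> where "linear \<psi>" "\<And>u. \<psi> (cstruct u) = cstruct (\<psi> u)" "\<And>u. \<psi> (E u) = E (\<psi> u)"
    "\<And>u v. \<psi> (D u v) = D (\<psi> u) (\<psi> v)"
    "\<And>u v. Omega (\<psi> u) (\<psi> v) = of_real (\<mu> ^ 5) * Omega u v"
    "\<And>u. coord (\<psi> u) 1 = of_real \<mu> * coord u 1" "c = c' * \<mu> ^ 5" "\<mu> \<noteq> 0"
proof -
  obtain \<psi> where aut: "lie_automorphism bracket \<psi>"
    and "\<psi> \<circ> cstruct = cstruct \<circ> \<psi>" "\<psi> \<circ> E = E \<circ> \<psi>"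
    and isom: "\<And>u v. herm E c' (\<psi> u) (\<psi> v) = herm E c u v"
    using assms(1) by (auto simp: equivalent_hypersymplectic_def)
  then have lin: "linear \<psi>" and \<psi>J: "\<And>u. \<psi> (cstruct u) = cstruct (\<psi> u)"
    and \<psi>E: "\<And>u. \<psi> (E u) = E (\<psi> u)"
    by (auto simp: lie_automorphism_def fun_eq_iff)
  have \<psi>D: "\<psi> (D u v) = D (\<psi> u) (\<psi> v)" for u v
    using lie_automorphism_levi_civita[OF aut isom metric_herm is_levi_civita_D is_levi_civita_D]
      assms by auto
  define l where "l = c / c'"
  have l: "l > 0"
    using assms by (simp add: l_def)
  have Im: "Im (Omega (\<psi> u) (\<psi> v)) = l * Im (Omega u v)" for u v
    using isom[of u "E v"] assms by (simp add: herm_def \<psi>E E_E l_def field_simps)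
  have Re: "Re (Omega (\<psi> u) (\<psi> v)) = l * Re (Omega u v)" for u v
    using Im[of "cstruct u" v] by (simp add: \<psi>J)
  have \<psi>\<Omega>: "Omega (\<psi> u) (\<psi> v) = of_real l * Omega u v" for u v
    using Im Re by (simp add: complex_eq_iff)
  define f where "f u = coord (\<psi> u) 1" for u
  have f: "of_real l * of_real (Re (coord u 1)) ^ 3 * coord v 1 * coord w 1 =
      of_real (Re (f u)) ^ 3 * f v * f w" for u v w
  proof -
    have "Omega (\<psi> (D u (D u (D u v)))) (\<psi> w) = Omega (D (\<psi> u) (D (\<psi> u) (D (\<psi> u) (\<psi> v)))) (\<psi> w)"
      by (simp add: \<psi>D)
    then show ?thesis
      unfolding \<psi>\<Omega> D_cubed by (simp add: f_def algebra_simps)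
  qed
  define e :: 'a where "e = vec_of (first_four 0 1 0 0)"
  have e: "coord e 1 = 1"
    by (simp add: e_def)
  \<comment> \<open>At \<open>cstruct e\<close> the real part of coordinate 1 vanishes, which kills
    the imaginary part of \<open>f e\<close>; at \<open>e\<close> itself the identity gives the
    fifth power.\<close>
  have "coord (cstruct e) 1 = \<i>" "f (cstruct e) = \<i> * f e"
    using e by (simp_all add: f_def \<psi>J)
  then have "of_real (Im (f e)) ^ 3 * f e * f e = 0"
    using f[of "cstruct e" e e] e by simp
  moreover have fe: "of_real l = of_real (Re (f e)) ^ 3 * f e * f e"
    using f[of e e e] e by simp
  then have "f e \<noteq> 0"
    using l by auto
  ultimately have "Im (f e) = 0"
    by simp
  define \<mu> where "\<mu> = Re (f e)"
  have fe\<mu>: "f e = of_real \<mu>"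
    using \<open>Im (f e) = 0\<close> by (simp add: \<mu>_def complex_eq_iff)
  then have "complex_of_real l = of_real (\<mu> ^ 5)"
    using fe by (simp add: power_numeral_reduce algebra_simps)
  then have l\<mu>: "l = \<mu> ^ 5"
    using of_real_eq_iff by blast
  have "\<mu> \<noteq> 0"
    using \<open>f e \<noteq> 0\<close> fe\<mu> by auto
  have "f u = of_real \<mu> * coord u 1" for u
  proof -
    show ?thesis
      using f[of e u e] e \<open>\<mu> \<noteq> 0\<close> by (auto simp: fe\<mu> l\<mu> power_numeral_reduce algebra_simps)
  qed
  moreover have "c = c' * \<mu> ^ 5"
    using assms by (simp add: l_def flip: l\<mu>)
  ultimately show ?thesis
    using that[of \<psi> \<mu>] lin \<psi>J \<psi>E \<psi>D \<psi>\<Omega> l\<mu> \<open>\<mu> \<noteq> 0\<close> by (simp add: f_def)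
qed

end

section \<open>The flat and the curved structure\<close>

context quaternionic_dimension
begin

lemma parallel_real_structure_flat: "parallel_real_structure n conj_flat (conn_flat :: 'a \<Rightarrow> 'a \<Rightarrow> 'a)"
proof (intro parallel_real_structure.intro parallel_real_structure_axioms.intro
    quaternionic_dimension_axioms)
  show "linear (conj_flat :: 'a \<Rightarrow> 'a)" "bilinear (conn_flat :: 'a \<Rightarrow> 'a \<Rightarrow> 'a)"
    by (fact linear_structs bilinear_conn)+
  fix u v w :: 'a
  show "conj_flat (conj_flat u) = u" "conj_flat (cstruct u) = - cstruct (conj_flat u)"
    by (rule coord_eqI; simp)+
  show "Omega (conj_flat u) (conj_flat v) = cnj (Omega u v)"
    unfolding Omega_split by (simp add: conj_flat_def coord_vec_of)
  show "conn_flat u (cstruct v) = cstruct (conn_flat u v)"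
    by (rule coord_eqI) (simp_all add: algebra_simps)
  show "conn_flat u (conj_flat v) = conj_flat (conn_flat u v)"
    by (rule coord_eqI) simp_all
  show "Omega (conn_flat u v) w + Omega v (conn_flat u w) = 0"
    unfolding Omega_split by (simp add: algebra_simps)
  show "conn_flat u v - conn_flat v u = bracket u v"
    by (simp add: bracket_def)
  \<comment> \<open>Only the chain of coordinates 1, 3, 2, 0 survives three applications, with
    factors \<open>x\<close>, \<open>12 * x\<close>, \<open>- x\<close> for
    \<open>x = Re (coord u 1)\<close>. The correction in \<open>conn_curved\<close> leaves this
    chain untouched.\<close>
  show "Omega (conn_flat u (conn_flat u (conn_flat u v))) w = - 12 * Re (coord u 1) ^ 3 * coord v 1 * coord w 1"
    unfolding Omega_split by (simp add: power3_eq_cube algebra_simps)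
qed

lemma parallel_real_structure_curved: "parallel_real_structure n conj_curved (conn_curved :: 'a \<Rightarrow> 'a \<Rightarrow> 'a)"
proof (intro parallel_real_structure.intro parallel_real_structure_axioms.intro
    quaternionic_dimension_axioms)
  show "linear (conj_curved :: 'a \<Rightarrow> 'a)" "bilinear (conn_curved :: 'a \<Rightarrow> 'a \<Rightarrow> 'a)"
    by (fact linear_structs bilinear_conn)+
  fix u v w :: 'a
  show "conj_curved (conj_curved u) = u" "conj_curved (cstruct u) = - cstruct (conj_curved u)"
    by (rule coord_eqI; simp add: algebra_simps)+
  show "Omega (conj_curved u) (conj_curved v) = cnj (Omega u v)"
    unfolding Omega_split by (simp add: algebra_simps)
  show "conn_curved u (cstruct v) = cstruct (conn_curved u v)"
    by (rule coord_eqI) (simp_all add: algebra_simps)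
  \<comment> \<open>Let \<open>A\<close> and \<open>B\<close> be the matrices of
    \<open>conn_flat u\<close> and of the correction, and let \<open>1 + N\<close> follow
    conjugation in \<open>conj_curved\<close>. As \<open>A\<close> is real, the claim reads
    \<open>B - cnj B + B N - N cnj B = N A - A N\<close>. The entry 12 in \<open>A\<close> times 1/3
    in \<open>N\<close> accounts for the factor \<open>2 * \<i>\<close> in \<open>B\<close>; the
    remaining entry matches because of the form of \<open>off_diag\<close>.\<close>
  show "conn_curved u (conj_curved v) = conj_curved (conn_curved u v)"
    by (rule coord_eqI) (simp_all add: field_simps complex_eq_iff off_diag_def)
  show "Omega (conn_curved u v) w + Omega v (conn_curved u w) = 0"
    unfolding Omega_split by (simp add: algebra_simps)
  show "conn_curved u v - conn_curved v u = bracket u v"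
    by (simp add: bracket_def conn_curved_def algebra_simps)
  show "Omega (conn_curved u (conn_curved u (conn_curved u v))) w = - 12 * Re (coord u 1) ^ 3 * coord v 1 * coord w 1"
    unfolding Omega_split by (simp add: power3_eq_cube algebra_simps)
qed

sublocale flat: parallel_real_structure n ty conj_flat conn_flat
  by (rule parallel_real_structure_flat)

sublocale curved: parallel_real_structure n ty conj_curved conn_curved
  by (rule parallel_real_structure_curved)

text \<open>Coordinate 1 and \<open>off_diag\<close> vanish on brackets, so flatness concerns only
  the entry from coordinate 1 to 0. There the commutator is twice
  \<open>off_diag u * Re (coord v 1) - Re (coord u 1) * off_diag v\<close>, and the coefficients 2
  and 8 in \<open>conn_flat\<close> make the bracket term equal to it.\<close>

lemma flat_metric_herm: "c \<noteq> 0 \<Longrightarrow> flat_metric bracket (herm conj_flat c :: 'a \<Rightarrow> 'a \<Rightarrow> real)"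
  unfolding flat_metric_def flat.levi_civita_D curvature_def bracket_def
  by (intro allI coord_eqI) (simp_all add: complex_eq_iff off_diag_def algebra_simps)

lemma coord_curvature_curved: "coord (curvature bracket conn_curved u v (w :: 'a)) 0 =
    6 * (Re (coord u 1) * Im (coord v 1) - Im (coord u 1) * Re (coord v 1)) * coord w 1"
  unfolding curvature_def bracket_def
  by (simp add: algebra_simps complex_eq_iff off_diag_def)

lemma curved_not_flat:
  assumes "c \<noteq> 0"
  shows "\<not> flat_metric bracket (herm conj_curved c :: 'a \<Rightarrow> 'a \<Rightarrow> real)"
proof
  assume "flat_metric bracket (herm conj_curved c :: 'a \<Rightarrow> 'a \<Rightarrow> real)"
  then have "curvature bracket conn_curved u v (w :: 'a) = 0" for u v w
    using assms by (simp add: flat_metric_def curved.levi_civita_D)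
  then show False
    \<comment> \<open>The coefficient is 6 times the area spanned by coordinate 1 of
      \<open>u\<close> and of \<open>v\<close>; the values 1 and \<open>\<i>\<close> span area
      1.\<close>
    using coord_curvature_curved[of "vec_of (first_four 0 1 0 0)" "vec_of (first_four 0 \<i> 0 0)"
        "vec_of (first_four 0 1 0 0)"]
    by simp
qed

text \<open>
  The cubed connection forces an equivalence to act as a dilation of weight 5 on \<^const>\<open>Omega\<close>;
  the curvature, respectively the commutators of the flat connection, force weight 4.
\<close>
lemma equivalent_curved:
  assumes "c > 0" "c' > 0"
    "equivalent_hypersymplectic bracket cstruct conj_curved (herm conj_curved c)
       cstruct conj_curved (herm conj_curved c' :: 'a \<Rightarrow> 'a \<Rightarrow> real)"
  shows "c = c'"
proof -
  obtain \<psi> :: "'a \<Rightarrow> 'a" and \<mu> where lin: "linear \<psi>" and J: "\<And>u. \<psi> (cstruct u) = cstruct (\<psi> u)"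
    and conn: "\<And>u v. \<psi> (conn_curved u v) = conn_curved (\<psi> u) (\<psi> v)"
    and Omega: "\<And>u v. Omega (\<psi> u) (\<psi> v) = of_real (\<mu> ^ 5) * Omega u v"
    and coord: "\<And>u. coord (\<psi> u) 1 = of_real \<mu> * coord u 1"
    and "c = c' * \<mu> ^ 5" "\<mu> \<noteq> 0"
    by (rule curved.equivalence_scales_Omega[OF assms(3,1,2)]) blast
  define e :: 'a where "e = vec_of (first_four 0 1 0 0)"
  define R where "R u v w = curvature bracket conn_curved u v w" for u v w :: 'a
  have Omega_R: "Omega (R u v w) z = 6 * (Re (coord u 1) * Im (coord v 1) - Im (coord u 1) * Re (coord v 1)) *
      coord w 1 * coord z 1" for u v w z
  proof -
    have "coord (R u v w) j = 0" if "j = 1 \<or> j = 2 \<or> j = 3 \<or> 4 \<le> j \<and> j < 2 * n" for j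
      using that unfolding R_def curvature_def bracket_def
      by (auto simp: algebra_simps complex_eq_iff off_diag_def)
    then show ?thesis
      unfolding Omega_split by (simp add: R_def coord_curvature_curved)
  qed
  have "\<psi> (bracket u v) = bracket (\<psi> u) (\<psi> v)" for u v
    by (simp add: conn linear_diff[OF lin] flip: curved.torsion_free)
  then have "\<psi> (R u v w) = R (\<psi> u) (\<psi> v) (\<psi> w)" for u v w
    by (simp add: R_def curvature_def linear_diff[OF lin] conn)
  \<comment> \<open>The curvature tensor has degree 4 in coordinate 1 and takes the value 6
    here.\<close>
  then have "of_real (\<mu> ^ 5) * Omega (R e (cstruct e) e) e =
      Omega (R (\<psi> e) (cstruct (\<psi> e)) (\<psi> e)) (\<psi> e)"
    using Omega[of "R e (cstruct e) e" e] by (simp add: J)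
  then have "complex_of_real (\<mu> ^ 5) = of_real (\<mu> ^ 4)"
    unfolding Omega_R coord by (simp add: e_def coord flip: One_nat_def) 
       (simp add: power_numeral_reduce)
  then have "\<mu> ^ 5 = \<mu> ^ 4"
    using of_real_eq_iff by blast
  then have "\<mu> = 1"
    using \<open>\<mu> \<noteq> 0\<close> by (simp add: power_numeral_reduce)
  then show ?thesis
    using \<open>c = c' * \<mu> ^ 5\<close> by simp
qed

lemma equivalent_flat:
  assumes "c > 0" "c' > 0"
    "equivalent_hypersymplectic bracket cstruct conj_flat (herm conj_flat c)
       cstruct conj_flat (herm conj_flat c' :: 'a \<Rightarrow> 'a \<Rightarrow> real)"
  shows "c = c'"
proof -
  obtain \<psi> :: "'a \<Rightarrow> 'a" and \<mu> where lin: "linear \<psi>" and J: "\<And>u. \<psi> (cstruct u) = cstruct (\<psi> u)"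
    and E: "\<And>u. \<psi> (conj_flat u) = conj_flat (\<psi> u)"
    and conn: "\<And>u v. \<psi> (conn_flat u v) = conn_flat (\<psi> u) (\<psi> v)"
    and Omega: "\<And>u v. Omega (\<psi> u) (\<psi> v) = of_real (\<mu> ^ 5) * Omega u v"
    and coord: "\<And>u. coord (\<psi> u) 1 = of_real \<mu> * coord u 1"
    and "c = c' * \<mu> ^ 5" "\<mu> \<noteq> 0"
    by (rule flat.equivalence_scales_Omega[OF assms(3,1,2)]) blast
  define e :: 'a where "e = vec_of (first_four 0 1 0 0)"
  \<comment> \<open>Flatness leaves no curvature to compare, but the commutator of the operators
    \<open>conn_flat u\<close> and \<open>conn_flat v\<close> is another invariant tensor.\<close>
  define R where "R u v w = conn_flat u (conn_flat v w) - conn_flat v (conn_flat u w)" for u v w :: 'a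
  have Omega_R: "Omega (R u v w) z = 2 * (off_diag u * Re (coord v 1) - Re (coord u 1) * off_diag v) *
      coord w 1 * coord z 1" for u v w z
    unfolding Omega_split R_def by (simp add: algebra_simps)
  \<comment> \<open>\<open>\<psi>\<close> preserves real vectors, and a real coordinate 3 drops out
    of \<open>off_diag (cstruct (\<psi> e))\<close>, which therefore has weight 1.\<close>
  have "conj_flat e = e"
    by (rule coord_eqI) (simp_all add: e_def coord_vec_of)
  then have "cnj (coord (\<psi> e) 3) = coord (\<psi> e) 3"
    using E[of e] coord_struct_simps(10)[of "\<psi> e"] by simp
  then have "Im (coord (\<psi> e) 3) = 0"
    by (simp add: complex_eq_iff)
  then have off_diag_e: "off_diag (cstruct (\<psi> e)) = 2 * \<mu>" "off_diag (cstruct e) = 2"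
    by (simp_all add: off_diag_def coord e_def flip: One_nat_def)
  have "\<psi> (R u v w) = R (\<psi> u) (\<psi> v) (\<psi> w)" for u v w
    by (simp add: R_def linear_diff[OF lin] conn)
  then have "of_real (\<mu> ^ 5) * Omega (R (cstruct e) e e) e =
      Omega (R (cstruct (\<psi> e)) (\<psi> e) (\<psi> e)) (\<psi> e)"
    using Omega[of "R (cstruct e) e e" e] by (simp add: J)
  then have "complex_of_real (\<mu> ^ 5) = of_real (\<mu> ^ 4)"
    unfolding Omega_R off_diag_e coord by (simp add: e_def coord flip: One_nat_def)
       (simp add: power_numeral_reduce)
  then have "\<mu> ^ 5 = \<mu> ^ 4"
    using of_real_eq_iff by blast
  then have "\<mu> = 1"
    using \<open>\<mu> \<noteq> 0\<close> by (simp add: power_numeral_reduce)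
  then show ?thesis
    using \<open>c = c' * \<mu> ^ 5\<close> by simp
qed

text \<open>Each bracketing loses one more coordinate in the order 1, 3, 2, 0; those from 4 on
  vanish at once. For the lower bound, \<open>y\<close> survives three brackets with
  \<open>x\<close>: the result has coordinate 0 equal to \<open>- 12 * \<i>\<close>.\<close>

lemma nilpotent_of_step_bracket: "nilpotent_of_step 4 (bracket :: 'a \<Rightarrow> 'a \<Rightarrow> 'a)"
proof -
  define W where "W S = {u :: 'a. \<forall>j\<in>S. coord u j = 0}" for S
  have sub: "subspace (W S)" for S
    by (auto simp: W_def subspace_def)
  have lc: "lower_central bracket (Suc k) \<subseteq> W S'"
    if "lower_central bracket k \<subseteq> W S" "\<And>u v. v \<in> W S \<Longrightarrow> bracket u v \<in> W S'" for k S S'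
    using that by (auto intro!: span_minimal[OF _ sub])
  let ?tail = "{4..<2 * n}"
  have 1: "lower_central bracket (Suc 0) \<subseteq> W ({1} \<union> ?tail)"
    by (rule lc[of _ "{}"]) (auto simp: W_def bracket_def)
  have 2: "lower_central bracket (Suc (Suc 0)) \<subseteq> W ({1, 3} \<union> ?tail)"
    by (rule lc[OF 1]) (auto simp: W_def bracket_def)
  have 3: "lower_central bracket (Suc (Suc (Suc 0))) \<subseteq> W ({1, 2, 3} \<union> ?tail)"
    by (rule lc[OF 2]) (auto simp: W_def bracket_def off_diag_def)
  have 4: "lower_central bracket (Suc (Suc (Suc (Suc 0)))) \<subseteq> W ({0, 1, 2, 3} \<union> ?tail)"
    by (rule lc[OF 3]) (auto simp: W_def bracket_def off_diag_def)
  also have "W ({0, 1, 2, 3} \<union> ?tail) \<subseteq> {0}"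
    by (auto simp: W_def intro: coord_eqI)
  finally have "lower_central bracket 4 \<subseteq> {0 :: 'a}"
    by (simp add: eval_nat_numeral)
  moreover have "0 \<in> lower_central bracket k" for k :: nat
    by (cases k) (auto simp: span_zero)
  ultimately have zero: "lower_central bracket 4 = {0 :: 'a}"
    by blast
  define x y :: 'a where "x = vec_of (first_four 0 1 0 0)" and "y = vec_of (first_four 0 \<i> 0 0)"
  define z where "z k = (bracket x ^^ k) y" for k
  have z: "z k \<in> lower_central bracket k" for k
    by (induction k) (auto simp: z_def intro!: span_base)
  have zero_Suc: "z (Suc k) = 0" if "z k = 0" for k
    using that coord_eqI[of "bracket x 0" 0] by (simp add: z_def bracket_def off_diag_def)
  have "z 3 = bracket x (bracket x (bracket x y))"
    by (simp add: z_def numeral_3_eq_3)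
  then have "coord (z 3) 0 \<noteq> 0"
    by (simp add: x_def y_def bracket_def complex_eq_iff off_diag_def)
  have z_neq_0: "z k \<noteq> 0" if "k \<le> 3" for k
    using that
  proof (induction rule: inc_induct)
    case base
    then show ?case
      using \<open>coord (z 3) 0 \<noteq> 0\<close> by auto
  next
    case (step k)
    then show ?case
      using zero_Suc by blast
  qed
  have "\<forall>j<4. lower_central bracket j \<noteq> {0 :: 'a}"
  proof (intro allI impI notI)
    fix j :: nat assume "j < 4" "lower_central bracket j = {0 :: 'a}"
    then show False
      using z[of j] z_neq_0[of j] by simp
  qed
  with zero show ?thesis
    by (simp add: nilpotent_of_step_def)
qed

end


section \<open>The nilmanifold\<close>

text \<open>
  The linear part of the affine action of \<open>u\<close>, obtained by integrating \<^const>\<open>conn_flat\<close>. The scale of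
  the coordinates is chosen such that all coefficients are integers, which makes the integer points
  a subgroup.
\<close>
definition translation :: "'a::euclidean_space \<Rightarrow> 'a \<Rightarrow> 'a"
  where "translation u v = v + vec_of (first_four
    (- Re (coord u 1) * coord v 2 + (off_diag u - 9 * Re (coord u 1) ^ 2) * coord v 3
      + (- 2 * Re (coord u 2) - 8 * Im (coord u 3) + 18 * Re (coord u 1) * Re (coord u 3)
         + 6 * Re (coord u 1) * Im (coord u 1) - 7 * Re (coord u 1) ^ 3) * coord v 1)
    0
    (12 * Re (coord u 1) * coord v 3 + (off_diag u + 3 * Re (coord u 1) ^ 2) * coord v 1)
    (Re (coord u 1) * coord v 1))"

definition group_mult :: "'a::euclidean_space \<Rightarrow> 'a \<Rightarrow> 'a"
  where "group_mult u v = u + translation u v"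

text \<open>Back substitution in \<open>translation u v = - u\<close>, in the order 1, 3, 2,
  0.\<close>

definition group_inv :: "'a::euclidean_space \<Rightarrow> 'a"
  where "group_inv u =
    (let x = Re (coord u 1);
         v1 = - coord u 1;
         v3 = - coord u 3 - x * v1;
         v2 = - coord u 2 - 12 * x * v3 - (off_diag u + 3 * x ^ 2) * v1;
         v0 = - coord u 0 + x * v2 - (off_diag u - 9 * x ^ 2) * v3
           - (- 2 * Re (coord u 2) - 8 * Im (coord u 3) + 18 * x * Re (coord u 3)
              + 6 * x * Im (coord u 1) - 7 * x ^ 3) * v1
     in vec_of (\<lambda>j. if j < 4 then first_four v0 v1 v2 v3 j else - coord u j))"

definition nil_group :: "'a::euclidean_space monoid"
  where "nil_group = \<lparr>carrier = UNIV, mult = group_mult, one = 0\<rparr>"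

lemma nil_group_simps [simp]:
  "carrier nil_group = UNIV" "x \<otimes>\<^bsub>nil_group\<^esub> y = group_mult x y" "\<one>\<^bsub>nil_group\<^esub> = 0"
  by (simp_all add: nil_group_def)

definition integer_points :: "'a::euclidean_space set"
  where "integer_points =
    {u. \<forall>j<DIM('a) div 2. Re (coord u j) \<in> \<int> \<and> Im (coord u j) \<in> \<int>}"

context quaternionic_dimension
begin

lemma coord_translation [simp]:
  "coord (translation u v :: 'a) 0 = coord v 0 - Re (coord u 1) * coord v 2
      + (off_diag u - 9 * Re (coord u 1) ^ 2) * coord v 3
      + (- 2 * Re (coord u 2) - 8 * Im (coord u 3) + 18 * Re (coord u 1) * Re (coord u 3)
         + 6 * Re (coord u 1) * Im (coord u 1) - 7 * Re (coord u 1) ^ 3) * coord v 1"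
  "coord (translation u v :: 'a) 1 = coord v 1"
  "coord (translation u v :: 'a) (Suc 0) = coord v 1"
  "coord (translation u v :: 'a) 2 = coord v 2 + 12 * Re (coord u 1) * coord v 3
      + (off_diag u + 3 * Re (coord u 1) ^ 2) * coord v 1"
  "coord (translation u v :: 'a) 3 = coord v 3 + Re (coord u 1) * coord v 1"
  "4 \<le> j \<Longrightarrow> j < 2 * n \<Longrightarrow> coord (translation u v :: 'a) j = coord v j"
  by (simp_all add: translation_def coord_vec_of)

lemma linear_translation: "linear (translation u :: 'a \<Rightarrow> 'a)"
  by (rule linearI; rule coord_eqI; simp add: algebra_simps)

lemma translation_0 [simp]: "translation 0 v = (v :: 'a)"
  by (rule coord_eqI) (simp_all add: off_diag_def)

text \<open>The linear parts multiply, which is what makes the group law associative.\<close>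
lemma translation_group_mult: "translation (group_mult u v) w = translation u (translation v (w :: 'a))"
  by (rule coord_eqI)
     (simp_all add: group_mult_def off_diag_def complex_eq_iff power2_eq_square power3_eq_cube algebra_simps)

lemma group_mult_assoc: "group_mult (group_mult u v) w = group_mult u (group_mult v (w :: 'a))"
proof -
  have "group_mult (group_mult u v) w = u + translation u v + translation u (translation v w)"
    using translation_group_mult[of u v w] by (simp add: group_mult_def)
  also have "\<dots> = group_mult u (group_mult v w)"
    by (simp add: group_mult_def linear_add[OF linear_translation])
  finally show ?thesis .
qed

lemma group_mult_0 [simp]: "group_mult 0 u = (u :: 'a)" "group_mult u 0 = (u :: 'a)"
  using linear_0[OF linear_translation] by (simp_all add: group_mult_def)

lemma coord_group_inv_ge_4: "4 \<le> j \<Longrightarrow> j < 2 * n \<Longrightarrow> coord (group_inv u :: 'a) j = - coord u j"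
  by (simp add: group_inv_def coord_vec_of Let_def)

lemma right_inverse: "group_mult u (group_inv u) = (0 :: 'a)"
  by (rule coord_eqI) (simp_all add: group_mult_def coord_group_inv_ge_4, simp_all add: group_inv_def Let_def)

lemma left_inverse: "group_mult (group_inv u) u = (0 :: 'a)"
  by (metis group_mult_0 group_mult_assoc right_inverse)

lemma group_nil_group: "group (nil_group :: 'a monoid)"
  by (rule groupI) (use left_inverse in \<open>auto simp: group_mult_assoc\<close>)

lemma inv_nil_group [simp]: "inv\<^bsub>nil_group\<^esub> u = group_inv (u :: 'a)"
  using group.inv_equality[OF group_nil_group, of "group_inv u" u] left_inverse by simp

section \<open>Smoothness of the group operations\<close>

lemma real_polynomial_function_coord:
  assumes "bounded_linear (h :: 'b::real_normed_vector \<Rightarrow> 'a)"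
  shows "real_polynomial_function (\<lambda>x. Re (coord (h x) j))" "real_polynomial_function (\<lambda>x. Im (coord (h x) j))"
  unfolding coord_def complex.sel
  by (intro real_polynomial_function.intros(1) bounded_linear_compose[OF bounded_linear_inner_left assms])+

lemma polynomial_function_coordI:
  fixes f :: "'b::real_normed_vector \<Rightarrow> 'a"
  assumes "\<And>j. j < 2 * n \<Longrightarrow>
    real_polynomial_function (\<lambda>x. Re (coord (f x) j)) \<and> real_polynomial_function (\<lambda>x. Im (coord (f x) j))"
  shows "polynomial_function f"
proof -
  have "DIM('a) div 2 = 2 * n"
    using dim by simp
  then have "f x = (\<Sum>j<2 * n. Re (coord (f x) j) *\<^sub>R onb (2 * j) + Im (coord (f x) j) *\<^sub>R onb (2 * j + 1))" for x
    using vec_of_coord[of "f x"] by (simp add: vec_of_def)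
  moreover have "polynomial_function
      (\<lambda>x. \<Sum>j<2 * n. Re (coord (f x) j) *\<^sub>R onb (2 * j) + Im (coord (f x) j) *\<^sub>R (onb (2 * j + 1) :: 'a))"
    using assms by (intro polynomial_function_sum polynomial_function_add polynomial_function_mult)
       (auto simp flip: real_polynomial_function_eq)
  ultimately show ?thesis
    by simp
qed

lemma index_cases:
  fixes j :: nat
  obtains "j = 0" | "j = 1" | "j = 2" | "j = 3" | "4 \<le> j"
  by linarith

lemma polynomial_group_mult: "polynomial_function (\<lambda>p :: 'a \<times> 'a. group_mult (fst p) (snd p))"
proof (rule polynomial_function_coordI)
  fix j assume j: "j < 2 * n"
  note poly = real_polynomial_function_coord[OF bounded_linear_fst] real_polynomial_function_coord[OF bounded_linear_snd]
  show "real_polynomial_function (\<lambda>p :: 'a \<times> 'a. Re (coord (group_mult (fst p) (snd p)) j)) \<and>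
        real_polynomial_function (\<lambda>p :: 'a \<times> 'a. Im (coord (group_mult (fst p) (snd p)) j))"
    by (cases j rule: index_cases)
       (use j in \<open>simp_all add: group_mult_def off_diag_def poly real_polynomial_function.intros
          real_polynomial_function_diff real_polynomial_function_minus real_polynomial_function_power\<close>)
qed

lemma polynomial_group_inv: "polynomial_function (group_inv :: 'a \<Rightarrow> 'a)"
proof (rule polynomial_function_coordI)
  fix j assume j: "j < 2 * n"
  note poly = real_polynomial_function_coord[OF bounded_linear_ident]
  show "real_polynomial_function (\<lambda>u :: 'a. Re (coord (group_inv u) j)) \<and>
        real_polynomial_function (\<lambda>u :: 'a. Im (coord (group_inv u) j))"
    by (cases j rule: index_cases)
       (use j in \<open>simp_all add: coord_group_inv_ge_4, simp_all add: group_inv_def Let_def off_diag_def poly real_polynomial_function.intros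
          real_polynomial_function_diff real_polynomial_function_minus real_polynomial_function_power\<close>)
qed

lemma continuous_on_group_mult:
  assumes "continuous_on S f" "continuous_on S g"
  shows "continuous_on S (\<lambda>x. group_mult (f x) (g x :: 'a))"
proof -
  have "continuous_on UNIV (\<lambda>p :: 'a \<times> 'a. group_mult (fst p) (snd p))"
    by (intro continuous_on_polymonial_function polynomial_group_mult)
  from continuous_on_compose2[OF this continuous_on_Pair[OF assms]] show ?thesis
    by simp
qed

text \<open>One global chart reduces smoothness to polynomiality of the group operations.\<close>

abbreviation (input) charts :: "('a, 'a) chart set"
  where "charts \<equiv> {(UNIV, id)}"

section \<open>The Lie algebra of the group\<close>

lemma has_derivative_group_mult: "(group_mult u has_derivative translation u) (at (v :: 'a))"
proof -
  have "(translation u has_derivative translation u) (at v)"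
    using linear_translation linear_conv_bounded_linear bounded_linear_imp_has_derivative by blast
  then show ?thesis
    unfolding group_mult_def by (auto intro!: derivative_eq_intros)
qed

text \<open>Left multiplication by \<open>u\<close> is affine, so its differential is the linear
  part \<open>translation u\<close> at every point.\<close>

lemma left_field_nil_group: "left_field nil_group (UNIV, id) (UNIV, id) X u = translation u (X :: 'a)"
  using frechet_derivative_at[OF has_derivative_group_mult[of u 0]] by (simp add: left_field_def)

text \<open>The first-order part of the left-invariant fields at the identity; skew-symmetrising it
  yields \<open>bracket\<close>.\<close>

lemma has_derivative_translation:
  "((\<lambda>u. translation u Y) has_derivative (\<lambda>h. conn_flat h (Y :: 'a))) (at 0)"
proof -
  define H where "H u = (vec_of (first_four
      (- 9 * Re (coord u 1) * coord Y 3 +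
        (18 * Re (coord u 3) + 6 * Im (coord u 1) - 7 * Re (coord u 1) ^ 2) * coord Y 1)
      0 (3 * Re (coord u 1) * coord Y 1) 0) :: 'a)" for u :: 'a
  txt \<open>All terms of higher order contain the factor \<open>Re (coord u 1)\<close>.\<close>
  have split: "translation u Y = Y + conn_flat u Y + Re (coord u 1) *\<^sub>R H u" for u
    by (rule coord_eqI) (simp_all add: H_def coord_vec_of power2_eq_square power3_eq_cube algebra_simps)
  note poly = real_polynomial_function_coord[OF bounded_linear_ident]
  have "polynomial_function H"
  proof (rule polynomial_function_coordI)
    fix j assume j: "j < 2 * n"
    show "real_polynomial_function (\<lambda>u :: 'a. Re (coord (H u) j)) \<and>
        real_polynomial_function (\<lambda>u :: 'a. Im (coord (H u) j))"
      by (cases j rule: index_cases)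
         (use j in \<open>simp_all add: H_def coord_vec_of poly real_polynomial_function.intros
            real_polynomial_function_diff real_polynomial_function_minus real_polynomial_function_power\<close>)
  qed
  then obtain H' where H': "(H has_derivative H') (at 0)"
    using polynomial_function_has_derivative by blast
  have "bounded_linear (\<lambda>u :: 'a. Re (coord u 1))"
    by (simp add: coord_def bounded_linear_inner_left)
  then have "((\<lambda>u :: 'a. Re (coord u 1)) has_derivative (\<lambda>u. Re (coord u 1))) (at 0)"
    by (rule bounded_linear_imp_has_derivative)
  from has_derivative_scaleR[OF this H']
  have "((\<lambda>u. Re (coord u 1) *\<^sub>R H u) has_derivative (\<lambda>h. Re (coord h 1) *\<^sub>R H 0)) (at 0)"
    by simp
  moreover have "H 0 = 0"
    by (rule coord_eqI) (simp_all add: H_def coord_vec_of)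
  ultimately have 1: "((\<lambda>u. Re (coord u 1) *\<^sub>R H u) has_derivative (\<lambda>h. 0)) (at 0)"
    by simp
  have 2: "((\<lambda>u. conn_flat u Y) has_derivative (\<lambda>h. conn_flat h Y)) (at 0)"
    using bilinear_conn(1) linear_conv_bounded_linear bounded_linear_imp_has_derivative
    unfolding bilinear_def by blast
  from has_derivative_add[OF has_derivative_add[OF has_derivative_const[of Y] 2] 1] show ?thesis
    unfolding split[abs_def] by simp
qed

lemma lie_bracket_nil_group: "lie_bracket nil_group (UNIV, id) = (bracket :: 'a \<Rightarrow> 'a \<Rightarrow> 'a)"
  by (intro ext)
     (simp add: lie_bracket_def left_field_nil_group bracket_def
       frechet_derivative_at[OF has_derivative_translation, symmetric])

lemma second_countable_euclidean: "second_countable (euclidean :: 'b::second_countable_topology topology)"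
proof -
  obtain B :: "'b set set" where "countable B" "topological_basis B"
    using ex_countable_basis by blast
  then show ?thesis
    unfolding second_countable_def
  proof (intro exI[of _ B] conjI ballI allI impI)
    show "openin euclidean V" if "V \<in> B" for V
      using that topological_basis_open[OF \<open>topological_basis B\<close>] by simp
    show "\<exists>V\<in>B. x \<in> V \<and> V \<subseteq> U" if "openin euclidean U \<and> x \<in> U" for U x
      using that topological_basisE[OF \<open>topological_basis B\<close>, of U x] by (metis open_openin)
  qed
qed

lemma lie_group_nil_group: "lie_group nil_group euclidean charts"
proof -
  interpret group "nil_group :: 'a monoid"
    by (rule group_nil_group)
  have "polynomial_function (id :: 'a \<Rightarrow> 'a)"
    unfolding id_def by (intro polynomial_function_bounded_linear bounded_linear_ident)
  then show ?thesis
    using polynomial_group_mult polynomial_group_inv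
    by unfold_locales
       (simp_all add: polynomial_function_smooth_on case_prod_unfold
          continuous_on_polymonial_function second_countable_euclidean)
qed

section \<open>Completeness\<close>

lemma triangular_coord_ode:
  fixes F :: "real \<Rightarrow> 'a \<Rightarrow> 'a"
  assumes cont: "continuous_on UNIV (\<lambda>(t, y). F t y)"
    and F1: "\<And>t y z. coord (F t y) 1 = coord (F t z) 1"
    and F4: "\<And>t y z j. 4 \<le> j \<Longrightarrow> j < 2 * n \<Longrightarrow> coord (F t y) j = coord (F t z) j"
    and F3: "\<And>t y z. coord y 1 = coord z 1 \<Longrightarrow> coord (F t y) 3 = coord (F t z) 3"
    and F2: "\<And>t y z. coord y 1 = coord z 1 \<Longrightarrow> coord y 3 = coord z 3 \<Longrightarrow> coord (F t y) 2 = coord (F t z) 2"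
    and F0: "\<And>t y z. coord y 1 = coord z 1 \<Longrightarrow> coord y 3 = coord z 3 \<Longrightarrow> coord y 2 = coord z 2 \<Longrightarrow>
      coord (F t y) 0 = coord (F t z) 0"
  shows "\<exists>y. y 0 = y0 \<and> (\<forall>t. (y has_vector_derivative F t (y t)) (at t))"
proof -
  \<comment> \<open>The order of integration: coordinate 1 and those from 4 on first, then 3, 2 and
    0.\<close>
  define rank :: "nat \<Rightarrow> nat"
    where "rank j = (if j = 3 then 1 else if j = 2 then 2 else if j = 0 then 3 else 0)" for j
  define \<pi> :: "nat \<Rightarrow> 'a \<Rightarrow> 'a"
    where "\<pi> k y = vec_of (\<lambda>j. if rank j < k then coord y j else 0)" for k y
  have coord_\<pi>: "coord (\<pi> k y) j = (if rank j < k then coord y j else 0)" if "j < 2 * n" for j k y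
    using that by (simp add: \<pi>_def coord_vec_of)
  have \<pi>_eq_iff: "\<pi> k y = \<pi> k z \<longleftrightarrow> (\<forall>j<2 * n. rank j < k \<longrightarrow> coord y j = coord z j)" for k y z
    using coord_eqI_all[of "\<pi> k y" "\<pi> k z"] coord_\<pi> by metis
  show ?thesis
  proof (rule triangular_ode_solution[OF cont, of \<pi> 4])
    show "linear (\<pi> k)" for k
      by (intro linearI coord_eqI_all) (simp_all add: coord_\<pi>)
    show "\<pi> 0 y = 0" for y
      by (rule coord_eqI_all) (simp add: coord_\<pi>)
    show "\<pi> 4 y = y" for y
      by (rule coord_eqI_all) (simp add: coord_\<pi> rank_def)
  next
    fix k t y z
    assume "\<pi> k y = \<pi> k z"
    then have eq: "coord y j = coord z j" if "j < 4" "rank j < k" for j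
      using that n_ge_2 by (simp add: \<pi>_eq_iff)
    have eq': "0 < k \<Longrightarrow> coord y 1 = coord z 1" "1 < k \<Longrightarrow> coord y 3 = coord z 3"
      "2 < k \<Longrightarrow> coord y 2 = coord z 2"
      using eq[of 1] eq[of 3] eq[of 2] by (simp_all add: rank_def)
    have "coord (F t y) j = coord (F t z) j" if "j < 2 * n" "rank j < Suc k" for j
    proof (cases j rule: index_cases)
      case 1
      then show ?thesis
        using that eq' F0[of y z] by (simp add: rank_def)
    next
      case 3
      then show ?thesis
        using that eq' F2[of y z] by (simp add: rank_def)
    next
      case 4
      then show ?thesis
        using that eq' F3[of y z] by (simp add: rank_def)
    qed (use that F1[of t y z] F4[of j t y z] in simp_all)
    then show "\<pi> (Suc k) (F t y) = \<pi> (Suc k) (F t z)"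
      by (simp add: \<pi>_eq_iff)
  qed
qed


text \<open>In the left-invariant frame the geodesic equation splits: the velocity solves
  \<open>x' = - D x x\<close>, and then the curve solves
  \<open>\<gamma>' = translation \<gamma> x\<close>. Both are triangular in the same order of
  coordinates, and the global lift \<open>\<gamma>\<close> serves as every local lift.\<close>

lemma complete_metric_nil_group:
  assumes D: "levi_civita bracket g = D" "bilinear D"
    and D_tri: "\<And>u v. coord (D u v) 1 = 0" "\<And>u v j. 4 \<le> j \<Longrightarrow> j < 2 * n \<Longrightarrow> coord (D u v) j = 0"
      "\<And>u v. coord u 1 = coord v 1 \<Longrightarrow> coord (D u u) 3 = coord (D v v) 3"
      "\<And>u v. coord u 1 = coord v 1 \<Longrightarrow> coord u 3 = coord v 3 \<Longrightarrow> coord (D u u) 2 = coord (D v v) 2"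
      "\<And>u v. coord u 1 = coord v 1 \<Longrightarrow> coord u 3 = coord v 3 \<Longrightarrow> coord u 2 = coord v 2 \<Longrightarrow>
         coord (D u u) 0 = coord (D v v) 0"
  shows "complete_metric nil_group euclidean charts (UNIV, id) \<Gamma> (g :: 'a \<Rightarrow> 'a \<Rightarrow> real)"
  unfolding complete_metric_def
proof (intro ballI allI)
  fix P :: "'a set" and X :: 'a
  assume "P \<in> rcosets\<^bsub>nil_group\<^esub> \<Gamma>"
  then obtain p where P: "P = \<Gamma> #>\<^bsub>nil_group\<^esub> p"
    by (auto simp: RCOSETS_def)
  have "continuous_on UNIV (\<lambda>(t::real, y). - D y y)"
    unfolding case_prod_unfold
    by (intro continuous_intros bilinear_continuous_on_compose[OF _ _ D(2)])
  then have "\<exists>x. x 0 = X \<and> (\<forall>t. (x has_vector_derivative - D (x t) (x t)) (at t))"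
  proof (rule triangular_coord_ode)
    fix y z :: 'a
    show "coord (- D y y) 1 = coord (- D z z) 1"
      by (simp add: D_tri(1) del: One_nat_def)
    show "coord (- D y y) j = coord (- D z z) j" if "4 \<le> j" "j < 2 * n" for j
      using that by (simp add: D_tri(2))
    assume 1: "coord y 1 = coord z 1"
    then show "coord (- D y y) 3 = coord (- D z z) 3"
      using D_tri(3)[of y z] by simp
    assume 3: "coord y 3 = coord z 3"
    with 1 show "coord (- D y y) 2 = coord (- D z z) 2"
      using D_tri(4)[of y z] by simp
    assume "coord y 2 = coord z 2"
    with 1 3 show "coord (- D y y) 0 = coord (- D z z) 0"
      using D_tri(5)[of y z] by simp
  qed
  then obtain x where x: "x 0 = X" "\<And>t. (x has_vector_derivative - D (x t) (x t)) (at t)"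
    by blast
  have cont_x: "continuous_on UNIV x"
    using has_vector_derivative_continuous[OF x(2)] by (simp add: continuous_at_imp_continuous_on)
  have "continuous_on UNIV (\<lambda>(t, y). translation y (x t))"
  proof -
    have "continuous_on UNIV (\<lambda>p. group_mult (snd p) (x (fst p)) - snd p)"
      by (intro continuous_intros continuous_on_group_mult continuous_on_compose2[OF cont_x]) auto
    then show ?thesis
      by (simp add: group_mult_def case_prod_unfold)
  qed
  then have "\<exists>\<gamma>. \<gamma> 0 = p \<and> (\<forall>t. (\<gamma> has_vector_derivative translation (\<gamma> t) (x t)) (at t))"
    by (rule triangular_coord_ode) (simp_all add: off_diag_def)
  then obtain \<gamma> where \<gamma>: "\<gamma> 0 = p" "\<And>t. (\<gamma> has_vector_derivative translation (\<gamma> t) (x t)) (at t)"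
    by blast
  have "continuous_on UNIV \<gamma>"
    using has_vector_derivative_continuous[OF \<gamma>(2)] by (simp add: continuous_at_imp_continuous_on)
  then have "continuous_on S \<gamma>" for S
    by (rule continuous_on_subset) simp
  then have "complete_geodesic nil_group euclidean charts (UNIV, id) \<Gamma> g (\<lambda>t. \<Gamma> #>\<^bsub>nil_group\<^esub> \<gamma> t) x"
    unfolding complete_geodesic_def has_left_velocity_def lie_bracket_nil_group D(1)
    using x(2) \<gamma>(2)
    by (intro conjI allI exI[of _ 1] exI[of _ \<gamma>])
       (auto simp: left_field_nil_group)
  then show "\<exists>\<sigma> x. complete_geodesic nil_group euclidean charts (UNIV, id) \<Gamma> g \<sigma> x \<and> \<sigma> 0 = P \<and> x 0 = X"
    using P x(1) \<gamma>(1) by blast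
qed

section \<open>The lattice of integer points\<close>

lemma subgroup_integer_points: "subgroup integer_points (nil_group :: 'a monoid)"
proof -
  interpret group "nil_group :: 'a monoid"
    by (rule group_nil_group)
  have half: "DIM('a) div 2 = 2 * n"
    using dim by simp
  show ?thesis
  proof (rule subgroupI)
    show "integer_points \<noteq> ({} :: 'a set)"
      by (auto simp: integer_points_def intro!: exI[of _ 0])
  next
    fix u :: 'a
    assume u: "u \<in> integer_points"
    have "Re (coord (group_inv u) j) \<in> \<int> \<and> Im (coord (group_inv u) j) \<in> \<int>" if "j < 2 * n" for j
      using u that half n_ge_2 unfolding integer_points_def
      by (cases j rule: index_cases)
         (simp_all add: coord_group_inv_ge_4, simp_all add: group_inv_def Let_def off_diag_def
            Ints_add Ints_diff Ints_minus Ints_mult Ints_power)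
    then show "inv\<^bsub>nil_group\<^esub> u \<in> integer_points"
      by (simp add: integer_points_def half)
  next
    fix u v :: 'a
    assume "u \<in> integer_points" "v \<in> integer_points"
    then have "Re (coord (group_mult u v) j) \<in> \<int> \<and> Im (coord (group_mult u v) j) \<in> \<int>" if "j < 2 * n" for j
      using that half n_ge_2 unfolding integer_points_def
      by (cases j rule: index_cases)
         (simp_all add: group_mult_def off_diag_def Ints_add Ints_diff Ints_minus Ints_mult Ints_power)
    then show "u \<otimes>\<^bsub>nil_group\<^esub> v \<in> integer_points"
      by (simp add: integer_points_def half)
  qed simp
qed

lemma discrete_integer_points:
  "subtopology euclidean integer_points = discrete_topology (integer_points :: 'a set)"
proof -
  have *: "x = y" if "x \<in> integer_points" "y \<in> integer_points" "dist x y < 1" for x y :: 'a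
  proof (rule coord_eqI_all)
    fix j assume j: "j < 2 * n"
    have "onb (2 * j) \<in> (Basis :: 'a set)" "onb (2 * j + 1) \<in> (Basis :: 'a set)"
      using bij_betw_onb[where 'a='a] j dim by (auto simp: bij_betw_def)
    then have "\<bar>(x - y) \<bullet> onb (2 * j)\<bar> < 1" "\<bar>(x - y) \<bullet> onb (2 * j + 1)\<bar> < 1"
      using Basis_le_norm[of _ "x - y"] that(3) le_less_trans by (simp_all add: dist_norm) blast+
    then have "\<bar>Re (coord x j) - Re (coord y j)\<bar> < 1" "\<bar>Im (coord x j) - Im (coord y j)\<bar> < 1"
      by (simp_all add: coord_def inner_diff_left)
    moreover have "Re (coord x j) \<in> \<int>" "Im (coord x j) \<in> \<int>" "Re (coord y j) \<in> \<int>" "Im (coord y j) \<in> \<int>"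
      using that j dim by (auto simp: integer_points_def)
    ultimately show "coord x j = coord y j"
      by (simp add: complex_eq_iff Ints_eq_abs_less1)
  qed
  have "integer_points \<inter> (euclidean :: 'a topology) derived_set_of integer_points = {}"
  proof (intro equals0I, elim IntE)
    fix x :: 'a
    assume x: "x \<in> integer_points" "x \<in> euclidean derived_set_of integer_points"
    then obtain y where "y \<noteq> x" "y \<in> integer_points" "y \<in> ball x 1"
      unfolding in_derived_set_of by (metis centre_in_ball open_ball open_openin zero_less_one)
    with x * show False
      by auto
  qed
  then show ?thesis
    by (simp add: subtopology_eq_discrete_topology_eq)
qed

text \<open>Each of the first four coordinates of \<open>group_mult \<gamma> u\<close> is that of
  \<open>\<gamma>\<close> plus a term in \<open>u\<close> and the coordinates of
  \<open>\<gamma>\<close> that come earlier in the order 1, 3, 2, 0. So the coordinates of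
  \<open>\<gamma>\<close> can be chosen in turn to cancel integer parts.\<close>

lemma integer_points_reduce: "\<exists>\<gamma>\<in>integer_points. group_mult \<gamma> u \<in> cbox 0 (One :: 'a)"
proof -
  define f where "f z = - Complex (of_int \<lfloor>Re z\<rfloor>) (of_int \<lfloor>Im z\<rfloor>)" for z
  have f: "Re (f z) \<in> \<int>" "Im (f z) \<in> \<int>" "0 \<le> Re (f z + z)" "Re (f z + z) \<le> 1" "0 \<le> Im (f z + z)" "Im (f z + z) \<le> 1" for z
    by (simp_all add: f_def) linarith+
  define g1 where "g1 = f (coord u 1)"
  define x where "x = Re g1"
  define g3 where "g3 = f (coord u 3 + x * coord u 1)"
  define q where "q = 6 * Re g3 + 2 * Im g1"
  define g2 where "g2 = f (coord u 2 + 12 * x * coord u 3 + (q + 3 * x ^ 2) * coord u 1)"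
  define g0 where "g0 = f (coord u 0 - x * coord u 2 + (q - 9 * x ^ 2) * coord u 3
      + (- 2 * Re g2 - 8 * Im g3 + 18 * x * Re g3 + 6 * x * Im g1 - 7 * x ^ 3) * coord u 1)"
  define \<gamma> :: 'a where "\<gamma> = vec_of (\<lambda>j. if j < 4 then first_four g0 g1 g2 g3 j else f (coord u j))"
  have \<gamma>: "coord \<gamma> 0 = g0" "coord \<gamma> 1 = g1" "coord \<gamma> 2 = g2" "coord \<gamma> 3 = g3"
    "\<And>j. 4 \<le> j \<Longrightarrow> j < 2 * n \<Longrightarrow> coord \<gamma> j = f (coord u j)"
    by (simp_all add: \<gamma>_def coord_vec_of)
  have q: "off_diag \<gamma> = q"
    by (simp add: off_diag_def q_def \<gamma> del: One_nat_def)
  have mult_f: "\<exists>z. coord \<gamma> j = f z \<and> coord (group_mult \<gamma> u) j = f z + z" if "j < 2 * n" for j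
    using that
    by (cases j rule: index_cases)
       (simp_all add: group_mult_def \<gamma> q del: One_nat_def,
        auto simp: g0_def g1_def g2_def g3_def x_def algebra_simps)
  have "\<gamma> \<in> integer_points"
    unfolding integer_points_def using mult_f f dim by fastforce
  moreover have "0 \<le> Re (coord (group_mult \<gamma> u) j) \<and> Re (coord (group_mult \<gamma> u) j) \<le> 1 \<and>
     0 \<le> Im (coord (group_mult \<gamma> u) j) \<and> Im (coord (group_mult \<gamma> u) j) \<le> 1" if "j < 2 * n" for j
    using mult_f[OF that] f(3-6) by metis
  moreover have "v \<in> cbox 0 One" if v: "\<And>j. j < 2 * n \<Longrightarrow> 0 \<le> Re (coord v j) \<and> Re (coord v j) \<le> 1 \<and>
     0 \<le> Im (coord v j) \<and> Im (coord v j) \<le> 1" for v :: 'a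
  proof -
    have "0 \<le> v \<bullet> b \<and> v \<bullet> b \<le> 1" if b: "b \<in> Basis" for b
    proof -
      obtain i where i: "i < 4 * n" "b = onb i"
        using bij_betw_onb[where 'a='a] dim b unfolding bij_betw_def by auto
      have "i = 2 * (i div 2) \<or> i = 2 * (i div 2) + 1"
        by presburger
      then show ?thesis
        using v[of "i div 2"] i by (auto simp: coord_def)
    qed
    then show ?thesis
      by (simp add: mem_box)
  qed
  ultimately show ?thesis
    by blast
qed

lemma lattice_integer_points: "lattice_in nil_group euclidean (integer_points :: 'a set)"
proof -
  interpret group "nil_group :: 'a monoid"
    by (rule group_nil_group)
  let ?f = "\<lambda>x :: 'a. integer_points #>\<^bsub>nil_group\<^esub> x"
  obtain Q where Q: "quotient_map euclidean Q ?f"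
    using quotient_map_exists by blast
  \<comment> \<open>Every coset meets the unit cube, so the quotient is the continuous image of a
    compact set.\<close>
  have "?f ` cbox 0 One = ?f ` UNIV"
  proof -
    have "?f u \<in> ?f ` cbox 0 One" for u
    proof -
      obtain \<gamma> where "\<gamma> \<in> integer_points" "group_mult \<gamma> u \<in> cbox 0 One"
        using integer_points_reduce by blast
      moreover from this have "?f u = ?f (group_mult \<gamma> u)"
        by (intro repr_independence subgroup_integer_points) (auto simp: r_coset_def)
      ultimately show ?thesis
        by blast
    qed
    then show ?thesis
      by blast
  qed
  moreover have "compactin Q (?f ` cbox 0 One)"
    using Q by (intro image_compactin[OF _ quotient_imp_continuous_map])
      (auto simp: compactin_euclidean_iff)
  ultimately have "compact_space Q"
    using quotient_imp_surjective_map[OF Q] by (simp add: compact_space_def)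
  then show ?thesis
    using Q subgroup_integer_points discrete_integer_points by (auto simp: lattice_in_def)
qed

lemma simply_connected_space_euclidean:
  "simply_connected_space (euclidean :: 'b::real_normed_vector topology)"
  unfolding simply_connected_space_def
proof (intro allI impI)
  fix p q :: "real \<Rightarrow> 'b"
  assume *: "pathin euclidean p \<and> p 1 = p 0 \<and> pathin euclidean q \<and> q 1 = q 0"
  \<comment> \<open>At each time \<open>s\<close> the convex combination of two loops is again a
    loop.\<close>
  define h where "h s t = (1 - s) *\<^sub>R p t + s *\<^sub>R q t" for s t :: real
  have "continuous_on {0..1} p" "continuous_on {0..1} q"
    using * by (auto simp: pathin_def)
  then have "continuous_on ({0..1} \<times> {0..1}) (\<lambda>x. h (fst x) (snd x))"
    unfolding h_def by (intro continuous_intros continuous_on_compose2[of "{0..1}" _ _ snd]) auto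
  then show "homotopic_with (\<lambda>r. r 1 = r 0) (top_of_set {0..1}) euclidean p q"
    unfolding homotopic_with_def using *
    by (intro exI[of _ "\<lambda>x. h (fst x) (snd x)"]) (auto simp: h_def simp flip: subtopology_Times euclidean_product_topology)
qed

section \<open>Assembly of the nilmanifold and its metrics\<close>

lemma nilmanifold_nil_group: "nilmanifold nil_group euclidean charts (UNIV, id) (integer_points :: 'a set)"
proof -
  interpret lie_group "nil_group :: 'a monoid" euclidean charts
    by (rule lie_group_nil_group)
  have "connected_space (euclidean :: 'a topology)"
    by (metis connected_UNIV connectedin_iff_connected connectedin_topspace topspace_euclidean)
  then show ?thesis
    using lattice_integer_points nilpotent_of_step_bracket simply_connected_space_euclidean
    by unfold_locales (auto simp: lie_bracket_nil_group)
qed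

lemma complete_flat:
  "c \<noteq> 0 \<Longrightarrow> complete_metric nil_group euclidean charts (UNIV, id) \<Gamma> (herm conj_flat c :: 'a \<Rightarrow> 'a \<Rightarrow> real)"
  by (rule complete_metric_nil_group[OF flat.levi_civita_D flat.bilinear_D]) (auto simp: off_diag_def)

lemma complete_curved:
  "c \<noteq> 0 \<Longrightarrow> complete_metric nil_group euclidean charts (UNIV, id) \<Gamma> (herm conj_curved c :: 'a \<Rightarrow> 'a \<Rightarrow> real)"
  by (rule complete_metric_nil_group[OF curved.levi_civita_D curved.bilinear_D]) (auto simp: off_diag_def)

end

theorem theorem5p5:
  fixes n :: nat
  assumes "n \<ge> 2" and "DIM('a::euclidean_space) = 4 * n"
  shows "\<exists>(G :: 'a monoid) (T :: 'a topology) (A :: ('a, 'a) chart set) e \<Gamma>.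
    nilmanifold G T A e \<Gamma> \<and>
    nilpotent_of_step 4 (lie_bracket G e) \<and>
    (\<exists>J E\<^sub>h g\<^sub>h E g.
      (\<forall>c::real. c > 0 \<longrightarrow>
         hypersymplectic (lie_bracket G e) (J c) (E\<^sub>h c) (g\<^sub>h c) \<and>
         hypersymplectic (lie_bracket G e) (J c) (E c) (g c)) \<and>
      (\<forall>c c'. c > 0 \<and> c' > 0 \<and> c \<noteq> c' \<longrightarrow>
         \<not> equivalent_hypersymplectic (lie_bracket G e)
              (J c) (E\<^sub>h c) (g\<^sub>h c) (J c') (E\<^sub>h c') (g\<^sub>h c') \<and>
         \<not> equivalent_hypersymplectic (lie_bracket G e)
              (J c) (E c) (g c) (J c') (E c') (g c')) \<and>
      (\<forall>c>0.
         flat_metric (lie_bracket G e) (g\<^sub>h c) \<and> complete_metric G T A e \<Gamma> (g\<^sub>h c) \<and>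
         \<not> flat_metric (lie_bracket G e) (g c) \<and> complete_metric G T A e \<Gamma> (g c)))"
proof -
  interpret quaternionic_dimension n "TYPE('a)"
    using assms by unfold_locales
  show ?thesis
    by (rule exI[of _ nil_group], rule exI[of _ euclidean], rule exI[of _ "{(UNIV, id)}"],
        rule exI[of _ "(UNIV, id)"], rule exI[of _ integer_points], unfold lie_bracket_nil_group,
        intro conjI nilmanifold_nil_group nilpotent_of_step_bracket exI[of _ "\<lambda>_. cstruct"]
          exI[of _ "\<lambda>_. conj_flat"] exI[of _ "herm conj_flat"]
          exI[of _ "\<lambda>_. conj_curved"] exI[of _ "herm conj_curved"])
       (use equivalent_flat equivalent_curved in \<open>auto simp: flat.hypersymplectic_herm curved.hypersymplectic_herm
          flat_metric_herm curved_not_flat complete_flat complete_curved\<close>)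
qed

end
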